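(* Let $\Phi_1,\Phi_2,\Phi_3$ be Young functions such that $$\Phi_1^{-1}(x)\,\Phi_2^{-1}(x)\le x\,\Phi_3^{-1}(x),\qquad x\ge 0.$$ If $M\in L^1(\mathbb R)$, then $M\in\tilde{\mathcal M}_{(\Phi_1,\Phi_2,\Phi_3)}(\mathbb R)$. Moreover $$\|M\|_{(\Phi_1,\Phi_2,\Phi_3)}\le 2\,C_{\Phi_3}(2)\,\|M\|_1.$$
   Context: A Young function is a function $\Phi:\mathbb R\to[0,\infty]$, not identically zero, which is convex, even and satisfies $\Phi(0)=0$. For $y\ge 0$, $\Phi^{-1}(y)=\inf\{x>0:\Phi(x)>y\}$ (with $\inf\emptyset=\infty$). The Orlicz space $L^\Phi(\mathbb R)$ consists of the measurable $f:\mathbb R\to\mathbb C$ (modulo a.e. equality) with $\int_{\mathbb R}\Phi(|f(x)|/\lambda)\,dx<\infty$ for some $\lambda>0$, with the Luxemburg norm $N_\Phi(f)=\inf\{\lambda>0:\int_{\mathbb R}\Phi(|f(x)|/\lambda)\,dx\le 1\}$. For $\lambda>0$, $D_\lambda f(x)=f(\lambda x)$ and $C_\Phi(\lambda)=\|D_\lambda\|_{L^\Phi(\mathbb R)\to L^\Phi(\mathbb R)}$ is its operator norm with respect to $N_\Phi$. The Fourier transform is $\hat f(\xi)=\int_{\mathbb R}f(x)e^{-2\pi i x\xi}\,dx$, and $\mathcal P(\mathbb R)$ is the set of $f\in L^1(\mathbb R)$ such that $\operatorname{supp}\hat f$ is compact. $\tilde{\mathcal M}_{(\Phi_1,\Phi_2,\Phi_3)}(\mathbb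 R)$ is the space of locally integrable functions $M:\mathbb R\to\mathbb C$ for which there is a constant $C>0$ such that the bilinear map $$B_M(f,g)(x)=\int_{\mathbb R}\int_{\mathbb R}\hat f(\xi)\hat g(\eta)M(\xi-\eta)e^{2\pi i(\xi+\eta)x}\,d\xi\,d\eta$$ satisfies $N_{\Phi_3}(B_M(f,g))\le C\,N_{\Phi_1}(f)N_{\Phi_2}(g)$ for all $f,g\in\mathcal P(\mathbb R)$; $\|M\|_{(\Phi_1,\Phi_2,\Phi_3)}$ is the infimum of such constants $C$. *)

theory Defs
  imports "HOL-Analysis.Analysis"
begin

text \<open>Values in \<open>[0,\<infinity>]\<close> are modelled by \<^typ>\<open>ennreal\<close>, with the library's convention \<open>0 * \<infinity> = 0\<close>.
  Functions modulo a.e. equality are represented by Lebesgue measurable functions.\<close>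

definition young_function :: "(real \<Rightarrow> ennreal) \<Rightarrow> bool" where
  "young_function \<Phi> \<longleftrightarrow>
     (\<forall>x y t. 0 \<le> t \<and> t \<le> 1 \<longrightarrow>
        \<Phi> ((1 - t) * x + t * y) \<le> ennreal (1 - t) * \<Phi> x + ennreal t * \<Phi> y) \<and>
     (\<forall>x. \<Phi> (- x) = \<Phi> x) \<and>
     \<Phi> 0 = 0 \<and>
     (\<exists>x. \<Phi> x \<noteq> 0)"

text \<open>In \<^typ>\<open>ennreal\<close>, the infimum of the empty set is \<open>\<infinity>\<close>.\<close>

definition young_inv :: "(real \<Rightarrow> ennreal) \<Rightarrow> real \<Rightarrow> ennreal" where
  "young_inv \<Phi> y = Inf {ennreal x | x. 0 < x \<and> ennreal y < \<Phi> x}"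

definition orlicz_modular :: "(real \<Rightarrow> ennreal) \<Rightarrow> (real \<Rightarrow> complex) \<Rightarrow> real \<Rightarrow> ennreal" where
  "orlicz_modular \<Phi> f l = (\<integral>\<^sup>+x. \<Phi> (cmod (f x) / l) \<partial>lebesgue)"

definition orlicz_space :: "(real \<Rightarrow> ennreal) \<Rightarrow> (real \<Rightarrow> complex) set" where
  "orlicz_space \<Phi> = {f \<in> borel_measurable lebesgue. \<exists>l>0. orlicz_modular \<Phi> f l < \<infinity>}"

text \<open>The Luxemburg norm is \<open>\<infinity>\<close> for measurable functions outside the Orlicz space.\<close>

definition luxemburg_norm :: "(real \<Rightarrow> ennreal) \<Rightarrow> (real \<Rightarrow> complex) \<Rightarrow> ennreal" where
  "luxemburg_norm \<Phi> f = Inf {ennreal l | l. 0 < l \<and> orlicz_modular \<Phi> f l \<le> 1}"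

definition dilation :: "real \<Rightarrow> (real \<Rightarrow> complex) \<Rightarrow> real \<Rightarrow> complex" where
  "dilation l f = (\<lambda>x. f (l * x))"

definition dilation_norm :: "(real \<Rightarrow> ennreal) \<Rightarrow> real \<Rightarrow> ennreal" where
  "dilation_norm \<Phi> l =
     Inf {ennreal C | C. 0 \<le> C \<and>
       (\<forall>f \<in> orlicz_space \<Phi>. luxemburg_norm \<Phi> (dilation l f) \<le> ennreal C * luxemburg_norm \<Phi> f)}"

definition fourier :: "(real \<Rightarrow> complex) \<Rightarrow> real \<Rightarrow> complex" where
  "fourier f \<xi> = (LINT x|lebesgue. f x * exp (- 2 * of_real pi * \<i> * of_real x * of_real \<xi>))"

text \<open>Since the transform of an integrable function is continuous, its support is the closure
  of the set where it does not vanish.\<close>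

definition compact_spectrum :: "(real \<Rightarrow> complex) set" where
  "compact_spectrum = {f. integrable lebesgue f \<and> compact (closure {\<xi>. fourier f \<xi> \<noteq> 0})}"

definition locally_integrable :: "(real \<Rightarrow> complex) \<Rightarrow> bool" where
  "locally_integrable M \<longleftrightarrow> (\<forall>K. compact K \<longrightarrow> set_integrable lebesgue K M)"

definition bilinear_op ::
    "(real \<Rightarrow> complex) \<Rightarrow> (real \<Rightarrow> complex) \<Rightarrow> (real \<Rightarrow> complex) \<Rightarrow> real \<Rightarrow> complex" where
  "bilinear_op M f g x =
     (LINT \<eta>|lebesgue. (LINT \<xi>|lebesgue.
        fourier f \<xi> * fourier g \<eta> * M (\<xi> - \<eta>) *
        exp (2 * of_real pi * \<i> * (of_real \<xi> + of_real \<eta>) * of_real x)))"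

definition multiplier_bound ::
    "(real \<Rightarrow> ennreal) \<Rightarrow> (real \<Rightarrow> ennreal) \<Rightarrow> (real \<Rightarrow> ennreal) \<Rightarrow> (real \<Rightarrow> complex) \<Rightarrow> real \<Rightarrow> bool" where
  "multiplier_bound \<Phi>1 \<Phi>2 \<Phi>3 M C \<longleftrightarrow>
     (\<forall>f \<in> compact_spectrum. \<forall>g \<in> compact_spectrum.
        luxemburg_norm \<Phi>3 (bilinear_op M f g)
          \<le> ennreal C * luxemburg_norm \<Phi>1 f * luxemburg_norm \<Phi>2 g)"

definition multiplier_space ::
    "(real \<Rightarrow> ennreal) \<Rightarrow> (real \<Rightarrow> ennreal) \<Rightarrow> (real \<Rightarrow> ennreal) \<Rightarrow> (real \<Rightarrow> complex) set" where
  "multiplier_space \<Phi>1 \<Phi>2 \<Phi>3 =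
     {M. locally_integrable M \<and> (\<exists>C>0. multiplier_bound \<Phi>1 \<Phi>2 \<Phi>3 M C)}"

definition multiplier_norm ::
    "(real \<Rightarrow> ennreal) \<Rightarrow> (real \<Rightarrow> ennreal) \<Rightarrow> (real \<Rightarrow> ennreal) \<Rightarrow> (real \<Rightarrow> complex) \<Rightarrow> ennreal" where
  "multiplier_norm \<Phi>1 \<Phi>2 \<Phi>3 M = Inf {ennreal C | C. 0 < C \<and> multiplier_bound \<Phi>1 \<Phi>2 \<Phi>3 M C}"

end

theory Submission
  imports Defs "HOL-Probability.Probability"
begin

text \<open>
  Substitute \<open>\<xi> = \<eta> + u\<close> in the double integral and invert the Fourier transform in \<open>\<eta>\<close>.  With the
  modulation \<open>f\<^sub>u(y) = e\<^bsup>-2\<pi>iuy\<^esup> f(y)\<close> this gives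
  \<open>B\<^sub>M(f,g)(x) = \<integral> M(u) e\<^bsup>2\<pi>iux\<^esup> (f\<^sub>u * g)(2x) du\<close>.  Modulation does not change absolute values, so
  \<open>\<bar>B\<^sub>M(f,g)(x)\<bar> \<le> \<parallel>M\<parallel>\<^sub>1 (\<bar>f\<bar> * \<bar>g\<bar>)(2x)\<close>: this is \<open>bilinear_op_bound\<close>.  The dilation by 2 costs
  the factor \<open>C\<^sub>\<Phi>\<^sub>3(2)\<close>, and what is left is O'Neil's convolution inequality
  \<open>N\<^sub>\<Phi>\<^sub>3(\<bar>f\<bar> * \<bar>g\<bar>) \<le> 2 N\<^sub>\<Phi>\<^sub>1(f) N\<^sub>\<Phi>\<^sub>2(g)\<close>, lemma \<open>luxemburg_norm_convolution_le\<close>.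

  O'Neil's inequality rests on a pointwise fact.  For \<open>a, b \<ge> 0\<close> put \<open>u = \<Phi>\<^sub>1(a)\<close>, \<open>v = \<Phi>\<^sub>2(b)\<close> and
  \<open>p = max u v\<close>.  The hypothesis on the inverses, combined with convexity, says that
  \<open>ab/p \<le> \<Phi>\<^sub>3\<^sup>-\<^sup>1(min u v)\<close>, that is, roughly, \<open>\<Phi>\<^sub>3(ab/p) \<le> min u v\<close> (\<open>oneil_pointwise\<close>).  Take \<open>a = f(y-t)\<close> and
  \<open>b = g(t)\<close> for nonnegative \<open>f, g\<close> normalised so that \<open>\<integral>\<Phi>\<^sub>1(f) \<le> 1\<close> and \<open>\<integral>\<Phi>\<^sub>2(g) \<le> 1\<close>.  Then \<open>(f * g)(y)/2\<close> is the
  integral of \<open>ab/p\<close> against the weight \<open>p/2\<close>, whose mass is at most 1 because \<open>p \<le> u + v\<close>.  Jensen's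
  inequality bounds \<open>\<Phi>\<^sub>3((f * g)(y)/2)\<close> by \<open>\<integral> (p/2) min u v = (1/2) \<integral> uv\<close>, and integrating over \<open>y\<close>
  leaves \<open>(1/2) \<integral>\<Phi>\<^sub>1(f) \<integral>\<Phi>\<^sub>2(g) \<le> 1\<close>.

  A Young function may jump to \<open>\<infinity>\<close> and need not be left continuous at the jump, so
  \<open>\<Phi>(\<Phi>\<^sup>-\<^sup>1(x)) \<le> x\<close> can fail.  For this reason the pointwise fact and Jensen's inequality are stated for
  arguments strictly below the critical value, and the constant 2 appears as an infimum over \<open>L > 2\<close>.

  Fourier inversion is needed almost everywhere for an integrable function with integrable transform.
  The function and the candidate for its inverse transform, both multiplied by a Gaussian, are integrable
  and have the same Fourier transform by Fubini, and Levy's uniqueness theorem for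
  characteristic functions identifies them (\<open>fourier_inversion\<close>).
\<close>

section \<open>Young functions and Jensen's inequality\<close>

lemma young_convex:
  assumes "young_function \<Phi>" "0 \<le> t" "t \<le> 1"
  shows "\<Phi> ((1 - t) * x + t * y) \<le> ennreal (1 - t) * \<Phi> x + ennreal t * \<Phi> y"
  using assms unfolding young_function_def by blast

lemma young_zero: "young_function \<Phi> \<Longrightarrow> \<Phi> 0 = 0"
  unfolding young_function_def by blast

lemma young_scale:
  assumes "young_function \<Phi>" "0 \<le> t" "t \<le> 1"
  shows "\<Phi> (t * x) \<le> ennreal t * \<Phi> x"
  using young_convex[OF assms, of 0 x] young_zero[OF assms(1)] by simp

lemma young_mono:
  assumes \<Phi>: "young_function \<Phi>" and "0 \<le> x" "x \<le> y"
  shows "\<Phi> x \<le> \<Phi> y"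
proof (cases "y = 0")
  case False
  with assms have "\<Phi> x \<le> ennreal (x / y) * \<Phi> y"
    using young_scale[OF \<Phi>, of "x / y" y] by simp
  also have "\<dots> \<le> 1 * \<Phi> y"
    using assms by (intro mult_right_mono) (auto simp: divide_le_eq_1)
  finally show ?thesis by simp
qed (use assms in auto)

text \<open>Sublevel sets are convex, hence intervals.\<close>

lemma young_borel_measurable:
  assumes \<Phi>: "young_function \<Phi>"
  shows "\<Phi> \<in> borel_measurable borel"
proof (rule borel_measurableI_le)
  fix a
  have "convex {x. \<Phi> x \<le> a}"
    unfolding convex_alt
  proof (clarsimp)
    fix x y t :: real
    assume *: "\<Phi> x \<le> a" "\<Phi> y \<le> a" "0 \<le> t" "t \<le> 1"
    have "\<Phi> ((1 - t) * x + t * y) \<le> ennreal (1 - t) * \<Phi> x + ennreal t * \<Phi> y"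
      using young_convex[OF \<Phi>] * by blast
    also have "\<dots> \<le> ennreal (1 - t) * a + ennreal t * a"
      using * by (intro add_mono mult_left_mono) auto
    also have "\<dots> = a"
      using * by (simp flip: distrib_right ennreal_plus)
    finally show "\<Phi> ((1 - t) * x + t * y) \<le> a" .
  qed
  then show "{x \<in> space borel. \<Phi> x \<le> a} \<in> sets borel"
    using real_interval_borel_measurable[of "{x. \<Phi> x \<le> a}"] is_interval_convex_1 by auto
qed

text \<open>Slopes of chords increase; finiteness at the right end point makes the three values real numbers.\<close>

lemma young_chord:
  assumes \<Phi>: "young_function \<Phi>" and le: "0 \<le> z" "z < s" "s < r" and fin: "\<Phi> r < \<infinity>"
  shows "(enn2real (\<Phi> s) - enn2real (\<Phi> z)) / (s - z)
           \<le> (enn2real (\<Phi> r) - enn2real (\<Phi> s)) / (r - s)"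
proof -
  define t where "t = (s - z) / (r - z)"
  have t: "0 \<le> t" "t \<le> 1" "t * (r - z) = s - z"
    using le by (auto simp: t_def)
  then have s: "s = (1 - t) * z + t * r"
    by (simp add: algebra_simps)
  have fin': "\<Phi> z < \<infinity>" "\<Phi> s < \<infinity>"
    using young_mono[OF \<Phi>, of z r] young_mono[OF \<Phi>, of s r] le fin by auto
  obtain pz ps pr where p: "\<Phi> z = ennreal pz" "\<Phi> s = ennreal ps" "\<Phi> r = ennreal pr"
      "0 \<le> pz" "0 \<le> ps" "0 \<le> pr"
    using fin fin' by (metis ennreal_cases infinity_ennreal_def less_irrefl)
  have "ennreal ps \<le> ennreal ((1 - t) * pz + t * pr)"
    using young_convex[OF \<Phi> t(1,2), of z r] t p s by (simp add: ennreal_mult)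
  then have "ps \<le> (1 - t) * pz + t * pr"
    using t p by (subst (asm) ennreal_le_iff) auto
  then have "ps * (r - z) \<le> ((1 - t) * pz + t * pr) * (r - z)"
    using le by (intro mult_right_mono) auto
  also have "\<dots> = (r - z - t * (r - z)) * pz + t * (r - z) * pr"
    by (simp add: algebra_simps)
  also have "\<dots> = (r - s) * pz + (s - z) * pr"
    using t by simp
  finally have "ps * (r - z) \<le> (r - s) * pz + (s - z) * pr" .
  then show ?thesis
    using le p by (simp add: field_simps)
qed

text \<open>An affine minorant \<open>z \<mapsto> m z - k\<close> of \<open>\<Phi>\<close> on \<open>[0,\<infinity>)\<close> whose value at \<open>A\<close> is at least \<open>c\<close>.  The
  gap \<open>s < A\<close> is essential when \<open>\<Phi>\<close> is infinite to the right of \<open>s\<close>: there the subgradient at \<open>s\<close> may be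
  vertical, while a line through \<open>(s, 0)\<close>, steep enough to reach \<open>c\<close> at \<open>A\<close>, does the job.
  It is written with \<open>k\<close> on the right so that both sides make sense in \<open>[0,\<infinity>]\<close>.\<close>

lemma young_affine_minorant:
  assumes \<Phi>: "young_function \<Phi>" and s: "0 \<le> s" "s < A" and c: "0 \<le> c" "ennreal c \<le> \<Phi> s"
  shows "\<exists>m k. 0 \<le> m \<and> 0 \<le> k \<and> c + k \<le> m * A \<and>
           (\<forall>z\<ge>0. ennreal (m * z) \<le> \<Phi> z + ennreal k)"
proof (cases "\<exists>r>s. \<Phi> r < \<infinity>")
  case False
  then have inf: "\<Phi> z = \<infinity>" if "s < z" for z
    using False that less_top by auto
  define m where "m = c / (A - s)"
  have m: "0 \<le> m" "m * A = c + m * s"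
    using s c by (auto simp: m_def field_simps)
  have "ennreal (m * z) \<le> \<Phi> z + ennreal (m * s)" if "0 \<le> z" for z
  proof (cases "z \<le> s")
    case True
    then have "ennreal (m * z) \<le> ennreal (m * s)"
      using m by (intro ennreal_leI mult_left_mono)
    then show ?thesis
      by (simp add: add_increasing)
  qed (use inf in auto)
  then show ?thesis
    using m s by (intro exI[of _ m] exI[of _ "m * s"]) auto
next
  case True
  then obtain r where r: "s < r" "\<Phi> r < \<infinity>"
    by blast
  show ?thesis
  proof (cases "s = 0")
    case True
    then have "c = 0"
      using c young_zero[OF \<Phi>] by auto
    then show ?thesis
      by (intro exI[of _ 0]) auto
  next
    case False
    with s have s0: "0 < s" by simp
    define p where "p z = enn2real (\<Phi> z)" for z
    define q where "q z = (p s - p z) / (s - z)" for z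
    \<comment> \<open>the left derivative at \<open>s\<close>, finite because it is bounded by the slope towards \<open>r\<close>\<close>
    define m where "m = (SUP z\<in>{0..<s}. q z)"
    have chord: "q z \<le> (p r' - p s) / (r' - s)" if "0 \<le> z" "z < s" "s < r'" "\<Phi> r' < \<infinity>" for z r'
      using young_chord[OF \<Phi> that] by (simp add: p_def q_def)
    have bdd: "bdd_above (q ` {0..<s})"
      using chord r by (intro bdd_aboveI[of _ "(p r - p s) / (r - s)"]) auto
    have lower: "q z \<le> m" if "0 \<le> z" "z < s" for z
      unfolding m_def using that bdd by (intro cSUP_upper) auto
    have upper: "m \<le> (p z - p s) / (z - s)" if "s < z" "\<Phi> z < \<infinity>" for z
      unfolding m_def using s0 chord that by (intro cSUP_least) auto
    have p0: "p 0 = 0"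
      by (simp add: p_def young_zero[OF \<Phi>])
    have k: "p s \<le> m * s"
      using lower[of 0] s0 by (simp add: q_def p0 field_simps)
    have ps: "0 \<le> p s"
      by (simp add: p_def)
    then have "0 \<le> m * s"
      using k by linarith
    then have m: "0 \<le> m"
      using s0 by (simp add: zero_le_mult_iff)
    have fin: "\<Phi> s < \<infinity>"
      using young_mono[OF \<Phi>, of s r] r s by auto
    have cps: "c \<le> p s"
      using c fin unfolding p_def
      by (metis enn2real_ennreal enn2real_mono infinity_ennreal_def)
    have "ennreal (m * z) \<le> \<Phi> z + ennreal (m * s - p s)" if z: "0 \<le> z" for z
    proof (cases "\<Phi> z < \<infinity>")
      case True
      have "m * z \<le> p z + (m * s - p s)"
      proof -
        consider "z < s" | "z = s" | "s < z" by linarith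
        then show ?thesis
        proof cases
          case 1
          then show ?thesis using lower[OF z 1] by (simp add: q_def field_simps)
        next
          case 3
          then show ?thesis using upper[OF 3 True] by (simp add: field_simps)
        qed auto
      qed
      then have "ennreal (m * z) \<le> ennreal (p z + (m * s - p s))"
        by (rule ennreal_leI)
      also have "\<dots> = \<Phi> z + ennreal (m * s - p s)"
        using True k by (subst ennreal_plus) (auto simp: p_def)
      finally show ?thesis .
    qed (auto simp flip: less_top)
    moreover have "c + (m * s - p s) \<le> m * A"
      using cps s m mult_left_mono[of s A m] by linarith
    ultimately show ?thesis
      using m k by (intro exI[of _ m] exI[of _ "m * s - p s"]) auto
  qed
qed

text \<open>Jensen's inequality for a weight of mass at most one; the missing mass is harmless
  because \<open>\<Phi> 0 = 0\<close>, so that affine minorants have intercept \<open>-k \<le> 0\<close>.  The strict inequality for \<open>s\<close>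
  makes up for a possible lack of left continuity of \<open>\<Phi>\<close>.\<close>

lemma young_jensen:
  assumes \<Phi>: "young_function \<Phi>"
    and v[measurable]: "v \<in> borel_measurable M" and w[measurable]: "w \<in> borel_measurable M"
    and w0: "\<And>x. 0 \<le> w x"
    and mass: "(\<integral>\<^sup>+x. v x \<partial>M) \<le> 1"
    and s: "0 \<le> s" "ennreal s < (\<integral>\<^sup>+x. v x * ennreal (w x) \<partial>M)"
  shows "\<Phi> s \<le> (\<integral>\<^sup>+x. v x * \<Phi> (w x) \<partial>M)"
proof -
  note [measurable] = young_borel_measurable[OF \<Phi>]
  obtain A where A: "s < A" "ennreal A < (\<integral>\<^sup>+x. v x * ennreal (w x) \<partial>M)"
  proof -
    obtain A' where A': "ennreal s < A'" "A' < (\<integral>\<^sup>+x. v x * ennreal (w x) \<partial>M)"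
      using s(2) dense by blast
    then obtain A where "A' = ennreal A" "0 \<le> A"
      by (cases A') auto
    with A' that s show ?thesis
      by (auto simp: ennreal_less_iff)
  qed
  have *: "ennreal c \<le> (\<integral>\<^sup>+x. v x * \<Phi> (w x) \<partial>M)" if c: "0 \<le> c" "ennreal c \<le> \<Phi> s" for c
  proof -
    obtain m k where mk: "0 \<le> m" "0 \<le> k" "c + k \<le> m * A"
        and le: "\<And>z. 0 \<le> z \<Longrightarrow> ennreal (m * z) \<le> \<Phi> z + ennreal k"
      using young_affine_minorant[OF \<Phi> s(1) A(1) c] by blast
    have "ennreal c + ennreal k \<le> ennreal m * ennreal A"
      using mk c A s by (simp flip: ennreal_plus ennreal_mult)
    also have "\<dots> \<le> ennreal m * (\<integral>\<^sup>+x. v x * ennreal (w x) \<partial>M)"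
      using A by (intro mult_left_mono) auto
    also have "\<dots> = (\<integral>\<^sup>+x. v x * ennreal (m * w x) \<partial>M)"
      using mk w0 by (subst nn_integral_cmult[symmetric]) (auto simp: ennreal_mult mult_ac)
    also have "\<dots> \<le> (\<integral>\<^sup>+x. v x * (\<Phi> (w x) + ennreal k) \<partial>M)"
      using le w0 by (intro nn_integral_mono mult_left_mono) auto
    also have "\<dots> = (\<integral>\<^sup>+x. v x * \<Phi> (w x) \<partial>M) + (\<integral>\<^sup>+x. v x \<partial>M) * ennreal k"
      by (simp add: distrib_left nn_integral_add nn_integral_multc)
    also have "\<dots> \<le> (\<integral>\<^sup>+x. v x * \<Phi> (w x) \<partial>M) + 1 * ennreal k"
      using mass by (intro add_mono mult_right_mono) auto
    finally show ?thesis
      by (simp add: ennreal_add_left_cancel_le add.commute)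
  qed
  show ?thesis
  proof (cases "\<Phi> s")
    case (real c)
    then show ?thesis using *[of c] by simp
  next
    case top
    show ?thesis
    proof (cases "\<integral>\<^sup>+x. v x * \<Phi> (w x) \<partial>M")
      case (real r)
      have "ennreal (r + 1) \<le> (\<integral>\<^sup>+x. v x * \<Phi> (w x) \<partial>M)"
        using *[of "r + 1"] top real by simp
      then show ?thesis using real by (simp add: ennreal_le_iff)
    qed simp
  qed
qed

section \<open>O'Neil's pointwise inequality\<close>

lemma le_young_inv:
  assumes "young_function \<Phi>" "0 \<le> a" "\<Phi> a \<le> ennreal x"
  shows "ennreal a \<le> young_inv \<Phi> x"
  unfolding young_inv_def
proof (rule Inf_greatest, clarify)
  fix z assume "0 < z" "ennreal x < \<Phi> z"
  then have "\<not> z \<le> a"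
    using young_mono[OF assms(1), of z a] assms(3) by (meson leD less_imp_le order_trans)
  then show "ennreal a \<le> ennreal z" by (simp add: ennreal_leI)
qed

lemma young_le_if_less_inv:
  assumes "young_function \<Phi>" "0 \<le> s" "ennreal s < young_inv \<Phi> x"
  shows "\<Phi> s \<le> ennreal x"
proof (cases "s = 0")
  case False
  show ?thesis
  proof (rule ccontr)
    assume "\<not> ?thesis"
    then have "young_inv \<Phi> x \<le> ennreal s"
      unfolding young_inv_def using False assms(2) by (intro Inf_lower) auto
    with assms(3) show False by simp
  qed
qed (simp add: young_zero[OF assms(1)])

text \<open>Let \<open>\<Phi>1 a \<le> x \<le> v\<close>.  Then \<open>a \<le> \<Phi>1\<^sup>-\<^sup>1(x)\<close>, and \<open>x b/v \<le> \<Phi>2\<^sup>-\<^sup>1(x)\<close> since convexity gives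
  \<open>\<Phi>2 (x b/v) \<le> (x/v) \<Phi>2 b = x\<close>.  Multiplying, \<open>x a b/v \<le> x \<Phi>3\<^sup>-\<^sup>1(x)\<close>, so \<open>s < a b/v \<le> \<Phi>3\<^sup>-\<^sup>1(x)\<close> forces
  \<open>\<Phi>3 s \<le> x\<close>.  If \<open>\<Phi>1 a > 0\<close>, take \<open>x = \<Phi>1 a\<close>; otherwise let \<open>x\<close> decrease to \<open>0\<close>, since the division by
  \<open>x\<close> forbids \<open>x = 0\<close>.\<close>

lemma oneil_pointwise_ordered:
  assumes \<Phi>1: "young_function \<Phi>1" and \<Phi>2: "young_function \<Phi>2" and \<Phi>3: "young_function \<Phi>3"
    and inv: "\<And>x::real. 0 \<le> x \<Longrightarrow>
           young_inv \<Phi>1 x * young_inv \<Phi>2 x \<le> ennreal x * young_inv \<Phi>3 x"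
    and ab: "0 \<le> a" "0 \<le> b" and v: "0 < v" "\<Phi>2 b = ennreal v" and u: "\<Phi>1 a \<le> ennreal v"
    and s: "0 \<le> s" "s < a * b / v"
  shows "\<Phi>3 s \<le> \<Phi>1 a"
proof -
  have le: "\<Phi>3 s \<le> ennreal x" if x: "0 < x" "x \<le> v" "\<Phi>1 a \<le> ennreal x" for x
  proof -
    have "\<Phi>2 (x / v * b) \<le> ennreal (x / v) * \<Phi>2 b"
      using x v by (intro young_scale[OF \<Phi>2]) auto
    also have "\<dots> = ennreal x"
      using x v by (simp flip: ennreal_mult)
    finally have "ennreal (x / v * b) \<le> young_inv \<Phi>2 x"
      using x v ab by (intro le_young_inv[OF \<Phi>2]) auto
    moreover have "ennreal a \<le> young_inv \<Phi>1 x"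
      by (intro le_young_inv[OF \<Phi>1]) (use ab x in auto)
    ultimately have "ennreal a * ennreal (x / v * b) \<le> young_inv \<Phi>1 x * young_inv \<Phi>2 x"
      by (intro mult_mono) auto
    also have "\<dots> \<le> ennreal x * young_inv \<Phi>3 x"
      using x by (intro inv) auto
    also have "ennreal a * ennreal (x / v * b) = ennreal x * ennreal (a * b / v)"
      using x v ab by (simp flip: ennreal_mult add: mult_ac)
    finally have "ennreal (a * b / v) \<le> young_inv \<Phi>3 x"
      using x by (subst (asm) ennreal_mult_le_mult_iff) auto
    moreover have "ennreal s < ennreal (a * b / v)"
      using s by (simp add: ennreal_less_iff)
    ultimately have "ennreal s < young_inv \<Phi>3 x"
      by order
    then show ?thesis
      by (rule young_le_if_less_inv[OF \<Phi>3 s(1)])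
  qed
  obtain u' where u': "\<Phi>1 a = ennreal u'" "0 \<le> u'" "u' \<le> v"
    using u v by (cases "\<Phi>1 a") (auto simp: ennreal_le_iff top_unique)
  show ?thesis
  proof (cases "u' = 0")
    case False
    then show ?thesis using le[of u'] u' by simp
  next
    case True
    show ?thesis
    proof (rule ccontr)
      assume "\<not> ?thesis"
      then have "0 < \<Phi>3 s" using u' True by (simp add: not_le zero_less_iff_neq_zero)
      then obtain e where e: "0 < e" "e < \<Phi>3 s" using dense by blast
      then obtain e' where e': "e = ennreal e'" "0 < e'" by (cases e) (auto simp: less_top)
      have "\<Phi>3 s \<le> ennreal (min e' v)"
        using e' v u' True by (intro le) auto
      also have "\<dots> \<le> e" using e' by (simp add: ennreal_leI)
      finally show False using e by simp
    qed
  qed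
qed

lemma oneil_pointwise:
  assumes \<Phi>1: "young_function \<Phi>1" and \<Phi>2: "young_function \<Phi>2" and \<Phi>3: "young_function \<Phi>3"
    and inv: "\<And>x::real. 0 \<le> x \<Longrightarrow>
           young_inv \<Phi>1 x * young_inv \<Phi>2 x \<le> ennreal x * young_inv \<Phi>3 x"
    and ab: "0 \<le> a" "0 \<le> b" and p: "0 < p" "max (\<Phi>1 a) (\<Phi>2 b) = ennreal p"
    and s: "0 \<le> s" "s < a * b / p"
  shows "\<Phi>3 s \<le> min (\<Phi>1 a) (\<Phi>2 b)"
proof (cases "\<Phi>1 a \<le> \<Phi>2 b")
  case True
  then show ?thesis
    using oneil_pointwise_ordered[OF \<Phi>1 \<Phi>2 \<Phi>3 inv ab p(1) _ _ s] p by (simp add: max_def)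
next
  case False
  have inv': "young_inv \<Phi>2 x * young_inv \<Phi>1 x \<le> ennreal x * young_inv \<Phi>3 x" if "0 \<le> x" for x
    using inv[OF that] by (simp add: mult.commute)
  have s': "s < b * a / p" using s by (simp add: mult.commute)
  show ?thesis
    using oneil_pointwise_ordered[OF \<Phi>2 \<Phi>1 \<Phi>3 inv' ab(2,1) p(1) _ _ s(1) s'] p False
    by (simp add: max_def min_def)
qed

text \<open>When \<open>max (\<Phi>1 a) (\<Phi>2 b) = 0\<close>, the quotient in \<open>oneil_pointwise\<close> is meaningless.  The
  assumption is the hypothesis on the inverses at \<open>x = 0\<close>.\<close>

lemma oneil_pointwise_zero:
  assumes \<Phi>1: "young_function \<Phi>1" and \<Phi>2: "young_function \<Phi>2"
    and inv: "young_inv \<Phi>1 0 * young_inv \<Phi>2 0 = 0"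
    and ab: "0 \<le> a" "0 \<le> b" and 0: "\<Phi>1 a = 0" "\<Phi>2 b = 0"
  shows "a * b = 0"
proof -
  have "ennreal a * ennreal b \<le> young_inv \<Phi>1 0 * young_inv \<Phi>2 0"
    using ab 0 by (intro mult_mono le_young_inv[OF \<Phi>1] le_young_inv[OF \<Phi>2]) auto
  then show ?thesis using inv ab by auto
qed

section \<open>The modular of a convolution\<close>

lemma max_mult_min_ennreal: "max a b * min a b = a * (b :: ennreal)"
  by (auto simp: max_def min_def mult.commute)

lemma nn_integral_lborel_reflect:
  fixes F :: "real \<Rightarrow> ennreal"
  assumes "F \<in> borel_measurable borel"
  shows "(\<integral>\<^sup>+t. F (y - t) \<partial>lborel) = (\<integral>\<^sup>+t. F t \<partial>lborel)"
  using nn_integral_real_affine[OF assms, of "-1" y] by simp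

lemma nn_integral_lborel_translate:
  fixes F :: "real \<Rightarrow> ennreal"
  assumes "F \<in> borel_measurable borel"
  shows "(\<integral>\<^sup>+y. F (y - t) \<partial>lborel) = (\<integral>\<^sup>+y. F y \<partial>lborel)"
  using nn_integral_real_affine[OF assms, of 1 "- t"] by simp

text \<open>Jensen's inequality with the weight \<open>p/2\<close>, where \<open>p\<close> is the larger of the two Young function values.  It turns
  the larger factor into mass and leaves the smaller one as the bound for \<open>\<Phi>3\<close>, so that their product
  \<open>max u v * min u v = u v\<close> appears and the two functions separate when integrated over \<open>y\<close>.\<close>

lemma oneil_convolution_pointwise:
  fixes a b :: "real \<Rightarrow> real"
  assumes \<Phi>1: "young_function \<Phi>1" and \<Phi>2: "young_function \<Phi>2" and \<Phi>3: "young_function \<Phi>3"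
    and inv: "\<And>x::real. 0 \<le> x \<Longrightarrow>
           young_inv \<Phi>1 x * young_inv \<Phi>2 x \<le> ennreal x * young_inv \<Phi>3 x"
    and [measurable]: "a \<in> borel_measurable borel" "b \<in> borel_measurable borel"
    and ab: "\<And>t. 0 \<le> a t" "\<And>t. 0 \<le> b t"
    and mod: "(\<integral>\<^sup>+t. \<Phi>1 (a t) \<partial>lborel) \<le> 1" "(\<integral>\<^sup>+t. \<Phi>2 (b t) \<partial>lborel) \<le> 1"
    and s: "0 \<le> s" "ennreal (2 * s) < (\<integral>\<^sup>+t. ennreal (a (y - t) * b t) \<partial>lborel)"
  shows "\<Phi>3 s \<le> (\<integral>\<^sup>+t. \<Phi>1 (a (y - t)) * \<Phi>2 (b t) \<partial>lborel) / 2"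
proof (cases "s = 0")
  case True
  then show ?thesis by (simp add: young_zero[OF \<Phi>3])
next
  case False
  with s have s0: "0 < s" by simp
  note [measurable] = young_borel_measurable[OF \<Phi>1] young_borel_measurable[OF \<Phi>2]
    young_borel_measurable[OF \<Phi>3]
  let ?H = "\<integral>\<^sup>+t. ennreal (a (y - t) * b t) \<partial>lborel"
  obtain s' where s': "s < s'" "ennreal (2 * s') < ?H"
  proof -
    obtain z where z: "ennreal (2 * s) < z" "z < ?H"
      using s(2) dense by blast
    then obtain r where "z = ennreal r" "0 \<le> r"
      by (cases z) auto
    with z that[of "r / 2"] s show ?thesis
      by (auto simp: ennreal_less_iff)
  qed
  \<comment> \<open>shrinking by \<open>\<theta> < 1\<close> puts the values of \<open>w\<close> strictly below \<open>a b / p\<close> and keeps their mean above \<open>s\<close>\<close>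
  define \<theta> where "\<theta> = s / s'"
  have \<theta>: "0 < \<theta>" "\<theta> < 1" "\<theta> * s' = s"
    using s0 s' by (auto simp: \<theta>_def)
  define p where "p t = max (\<Phi>1 (a (y - t))) (\<Phi>2 (b t))" for t
  define w where "w t = \<theta> * (a (y - t) * b t / enn2real (p t))" for t
  have [measurable]: "p \<in> borel_measurable borel" "w \<in> borel_measurable borel"
    unfolding p_def[abs_def] w_def[abs_def] by measurable
  have refl: "(\<integral>\<^sup>+t. \<Phi>1 (a (y - t)) \<partial>lborel) \<le> 1"
    using mod(1) by (subst nn_integral_lborel_reflect[where F = "\<lambda>t. \<Phi>1 (a t)"]) auto
  have "(\<integral>\<^sup>+t. p t \<partial>lborel) \<le> (\<integral>\<^sup>+t. \<Phi>1 (a (y - t)) + \<Phi>2 (b t) \<partial>lborel)"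
    by (intro nn_integral_mono) (auto simp: p_def)
  also have "\<dots> \<le> 1 + 1"
    using refl mod(2) by (subst nn_integral_add) (auto intro!: add_mono simp del: one_add_one)
  finally have p2: "(\<integral>\<^sup>+t. p t \<partial>lborel) \<le> 2"
    by simp
  then have fin: "AE t in lborel. p t \<noteq> \<infinity>"
    by (intro nn_integral_PInf_AE) (auto simp: top_unique)
  have mass: "(\<integral>\<^sup>+t. p t / 2 \<partial>lborel) \<le> 1"
    using divide_right_mono_ennreal[OF p2, of 2] by (simp add: nn_integral_divide)
  \<comment> \<open>where both Young functions vanish the product vanishes too, so no mass is lost\<close>
  have ab0: "a (y - t) * b t = 0" if "p t = 0" for t
    using that inv[of 0] ab
    by (intro oneil_pointwise_zero[OF \<Phi>1 \<Phi>2]) (auto simp: p_def max_def split: if_splits)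
  have pw: "p t / 2 * ennreal (w t) = ennreal (\<theta> / 2) * ennreal (a (y - t) * b t)"
    if "p t \<noteq> \<infinity>" for t
  proof (cases "p t")
    case (real r)
    show ?thesis
    proof (cases "r = 0")
      case True
      then show ?thesis using ab0[of t] real by auto
    next
      case False
      then show ?thesis
        using real \<theta> ab ennreal_divide_numeral[of r]
        by (simp add: w_def ennreal_mult'[symmetric] mult_ac)
    qed
  qed (use that in auto)
  have "ennreal s = ennreal (\<theta> / 2) * ennreal (2 * s')"
    using \<theta> s0 s' by (simp flip: ennreal_mult)
  also have "\<dots> < ennreal (\<theta> / 2) * ?H"
    using \<theta> s'(2) by (intro ennreal_mult_strict_left_mono) auto
  also have "\<dots> = (\<integral>\<^sup>+t. ennreal (\<theta> / 2) * ennreal (a (y - t) * b t) \<partial>lborel)"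
    by (subst nn_integral_cmult) auto
  also have "\<dots> = (\<integral>\<^sup>+t. p t / 2 * ennreal (w t) \<partial>lborel)"
    using fin pw by (intro nn_integral_cong_AE) (auto elim: AE_mp)
  finally have "\<Phi>3 s \<le> (\<integral>\<^sup>+t. p t / 2 * \<Phi>3 (w t) \<partial>lborel)"
    using mass s ab \<theta> by (intro young_jensen[OF \<Phi>3]) (auto simp: w_def)
  also have "\<dots> \<le> (\<integral>\<^sup>+t. \<Phi>1 (a (y - t)) * \<Phi>2 (b t) / 2 \<partial>lborel)"
  proof (rule nn_integral_mono_AE, use fin in eventually_elim)
    fix t assume "p t \<noteq> \<infinity>"
    then obtain r where r: "p t = ennreal r" "0 \<le> r"
      by (cases "p t") auto
    have "p t * \<Phi>3 (w t) \<le> p t * min (\<Phi>1 (a (y - t))) (\<Phi>2 (b t))"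
    proof (cases "r = 0 \<or> a (y - t) * b t = 0")
      case True
      then show ?thesis using r by (auto simp: w_def young_zero[OF \<Phi>3])
    next
      case False
      then have "0 < a (y - t) * b t" "0 < r"
        using ab[of "y - t"] ab[of t] r by (auto simp: less_le)
      then have "w t < a (y - t) * b t / r" "0 \<le> w t"
        using \<theta> r by (auto simp: w_def mult_less_cancel_right2 divide_strict_right_mono field_simps)
      then show ?thesis
        using ab r \<open>0 < r\<close>
        by (intro mult_left_mono oneil_pointwise[OF \<Phi>1 \<Phi>2 \<Phi>3 inv, where p = r]) (auto simp: p_def)
    qed
    also have "\<dots> = \<Phi>1 (a (y - t)) * \<Phi>2 (b t)"
      by (simp add: p_def max_mult_min_ennreal)
    finally have "p t * \<Phi>3 (w t) \<le> \<Phi>1 (a (y - t)) * \<Phi>2 (b t)" .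
    from divide_right_mono_ennreal[OF this, of 2]
    show "p t / 2 * \<Phi>3 (w t) \<le> \<Phi>1 (a (y - t)) * \<Phi>2 (b t) / 2"
      by (simp add: divide_ennreal_def mult_ac)
  qed
  also have "\<dots> = (\<integral>\<^sup>+t. \<Phi>1 (a (y - t)) * \<Phi>2 (b t) \<partial>lborel) / 2"
    by (simp add: nn_integral_divide)
  finally show ?thesis .
qed

text \<open>The convolution of \<open>\<bar>f\<bar>\<close> and \<open>\<bar>g\<bar>\<close>, with values in \<open>[0,\<infinity>]\<close>: where it diverges a
  Bochner integral would be \<open>0\<close>, and the upper bounds by it would be false.\<close>

definition abs_convolution :: "(real \<Rightarrow> complex) \<Rightarrow> (real \<Rightarrow> complex) \<Rightarrow> real \<Rightarrow> ennreal" where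
  "abs_convolution f g y = (\<integral>\<^sup>+t. ennreal (cmod (f (y - t)) * cmod (g t)) \<partial>lborel)"

lemma abs_convolution_measurable [measurable]:
  assumes [measurable]: "f \<in> borel_measurable borel" "g \<in> borel_measurable borel"
  shows "abs_convolution f g \<in> borel_measurable borel"
  unfolding abs_convolution_def[abs_def] by measurable

text \<open>O'Neil's inequality for modulars.  The value \<open>L = 2\<close> is excluded because
  \<open>oneil_convolution_pointwise\<close> needs an argument strictly below half the convolution.\<close>

lemma oneil_convolution_modular:
  assumes \<Phi>1: "young_function \<Phi>1" and \<Phi>2: "young_function \<Phi>2" and \<Phi>3: "young_function \<Phi>3"
    and inv: "\<And>x::real. 0 \<le> x \<Longrightarrow>
           young_inv \<Phi>1 x * young_inv \<Phi>2 x \<le> ennreal x * young_inv \<Phi>3 x"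
    and [measurable]: "f \<in> borel_measurable borel" "g \<in> borel_measurable borel"
    and l: "0 < l1" "orlicz_modular \<Phi>1 f l1 \<le> 1" "0 < l2" "orlicz_modular \<Phi>2 g l2 \<le> 1"
    and L: "2 < L"
  shows "orlicz_modular \<Phi>3 (\<lambda>y. complex_of_real (enn2real (abs_convolution f g y))) (L * (l1 * l2)) \<le> 1"
proof -
  note [measurable] = young_borel_measurable[OF \<Phi>1] young_borel_measurable[OF \<Phi>2]
    young_borel_measurable[OF \<Phi>3]
  define a where "a t = cmod (f t) / l1" for t
  define b where "b t = cmod (g t) / l2" for t
  have [measurable]: "a \<in> borel_measurable borel" "b \<in> borel_measurable borel"
    unfolding a_def[abs_def] b_def[abs_def] by measurable
  have ab: "0 \<le> a t" "0 \<le> b t" for t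
    using l by (auto simp: a_def b_def)
  have mod: "(\<integral>\<^sup>+t. \<Phi>1 (a t) \<partial>lborel) \<le> 1" "(\<integral>\<^sup>+t. \<Phi>2 (b t) \<partial>lborel) \<le> 1"
    using l by (auto simp: orlicz_modular_def a_def b_def nn_integral_completion)
  let ?U = "\<lambda>y. \<integral>\<^sup>+t. \<Phi>1 (a (y - t)) * \<Phi>2 (b t) \<partial>lborel"
  have pt: "\<Phi>3 (enn2real (abs_convolution f g y) / (L * (l1 * l2))) \<le> ?U y / 2" for y
  proof -
    define H where "H = enn2real (abs_convolution f g y)"
    define s where "s = H / (L * (l1 * l2))"
    have s: "0 \<le> s" using l L by (simp add: s_def H_def)
    show ?thesis
    proof (cases "H = 0")
      case True
      then show ?thesis by (simp add: H_def young_zero[OF \<Phi>3])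
    next
      case False
      then have H: "0 < H" "abs_convolution f g y = ennreal H"
        unfolding H_def by (auto simp: enn2real_eq_0_iff less_le ennreal_enn2real_if)
      have "(\<integral>\<^sup>+t. ennreal (a (y - t) * b t) \<partial>lborel)
          = (\<integral>\<^sup>+t. ennreal (1 / (l1 * l2)) * ennreal (cmod (f (y - t)) * cmod (g t)) \<partial>lborel)"
        using l by (intro nn_integral_cong) (simp add: a_def b_def flip: ennreal_mult)
      also have "\<dots> = ennreal (1 / (l1 * l2)) * ennreal H"
        using H(2) by (subst nn_integral_cmult) (auto simp: abs_convolution_def)
      also have "\<dots> = ennreal (H / (l1 * l2))"
        using l H by (simp flip: ennreal_mult)
      also have "\<dots> > ennreal (2 * s)"
        using l H L by (auto simp: s_def ennreal_less_iff field_simps)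
      finally show ?thesis
        using oneil_convolution_pointwise[OF \<Phi>1 \<Phi>2 \<Phi>3 inv _ _ ab mod s, of y]
        by (simp add: s_def H_def)
    qed
  qed
  have "orlicz_modular \<Phi>3 (\<lambda>y. complex_of_real (enn2real (abs_convolution f g y))) (L * (l1 * l2))
      \<le> (\<integral>\<^sup>+y. ?U y / 2 \<partial>lborel)"
    unfolding orlicz_modular_def nn_integral_completion by (intro nn_integral_mono) (simp add: pt)
  also have "\<dots> = (\<integral>\<^sup>+y. ?U y \<partial>lborel) / 2"
    by (subst nn_integral_divide) auto
  also have "(\<integral>\<^sup>+y. ?U y \<partial>lborel) = (\<integral>\<^sup>+t. (\<integral>\<^sup>+y. \<Phi>1 (a (y - t)) * \<Phi>2 (b t) \<partial>lborel) \<partial>lborel)"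
    by (rule lborel_pair.Fubini') simp
  also have "\<dots> = (\<integral>\<^sup>+t. (\<integral>\<^sup>+y. \<Phi>1 (a y) \<partial>lborel) * \<Phi>2 (b t) \<partial>lborel)"
    by (simp add: nn_integral_multc nn_integral_lborel_translate[where F = "\<lambda>y. \<Phi>1 (a y)"])
  also have "\<dots> \<le> 1 * 1"
    using mult_mono[OF mod] by (subst nn_integral_cmult) auto
  finally have "orlicz_modular \<Phi>3 (\<lambda>y. complex_of_real (enn2real (abs_convolution f g y))) (L * (l1 * l2))
      \<le> 1 * 1 / 2"
    by (rule order_trans) (auto intro!: divide_right_mono_ennreal)
  also have "\<dots> \<le> 1"
    by (rule divide_le_posI_ennreal) auto
  finally show ?thesis .
qed

section \<open>Luxemburg norms\<close>

text \<open>The bounds on \<open>c\<close> exclude the failures caused by \<open>0 * \<infinity> = 0\<close>: with \<open>c = 0\<close> and \<open>S\<close> empty, or with \<open>c = \<infinity>\<close> and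
  \<open>Inf S = 0\<close>, the right-hand side is \<open>0\<close>.\<close>

lemma le_mult_Inf_ennreal:
  fixes c x :: ennreal
  assumes c: "0 < c" "c < \<top>" and le: "\<And>l. l \<in> S \<Longrightarrow> x \<le> c * l"
  shows "x \<le> c * Inf S"
proof -
  have "x / c \<le> Inf S"
    using c le by (intro Inf_greatest divide_le_posI_ennreal) (auto simp: mult.commute)
  then have "c * (x / c) \<le> c * Inf S"
    by (intro mult_left_mono) auto
  also have "c * (x / c) = x"
    using c by (subst ennreal_times_divide, subst mult.commute, subst ennreal_mult_divide_eq) auto
  finally show ?thesis .
qed

lemma luxemburg_norm_mono_AE:
  assumes \<Phi>: "young_function \<Phi>" and le: "AE x in lborel. cmod (f x) \<le> cmod (g x)"
  shows "luxemburg_norm \<Phi> f \<le> luxemburg_norm \<Phi> g"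
proof -
  have "orlicz_modular \<Phi> f l \<le> orlicz_modular \<Phi> g l" if "0 < l" for l
    unfolding orlicz_modular_def nn_integral_completion
    by (rule nn_integral_mono_AE, use le in eventually_elim)
       (use that in \<open>auto intro!: young_mono[OF \<Phi>] divide_right_mono\<close>)
  then show ?thesis
    unfolding luxemburg_norm_def by (intro Inf_superset_mono) (auto intro: order_trans)
qed

lemma luxemburg_norm_cong_AE:
  assumes \<Phi>: "young_function \<Phi>" and eq: "AE x in lborel. f x = g x"
  shows "luxemburg_norm \<Phi> f = luxemburg_norm \<Phi> g"
  by (intro antisym luxemburg_norm_mono_AE[OF \<Phi>]; use eq in eventually_elim; simp)

lemma luxemburg_norm_le:
  "0 < l \<Longrightarrow> orlicz_modular \<Phi> f l \<le> 1 \<Longrightarrow> luxemburg_norm \<Phi> f \<le> ennreal l"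
  unfolding luxemburg_norm_def by (intro Inf_lower) auto

lemma luxemburg_norm_zero_fun:
  assumes \<Phi>: "young_function \<Phi>"
  shows "luxemburg_norm \<Phi> (\<lambda>x. 0) = 0"
proof -
  have "luxemburg_norm \<Phi> (\<lambda>x. 0) \<le> 0"
  proof (rule ennreal_le_epsilon)
    fix e :: real assume "0 < e"
    then show "luxemburg_norm \<Phi> (\<lambda>x. 0) \<le> 0 + ennreal e"
      using luxemburg_norm_le[of e \<Phi> "\<lambda>x. 0"] by (simp add: orlicz_modular_def young_zero[OF \<Phi>])
  qed
  then show ?thesis by simp
qed

lemma luxemburg_norm_scale_le:
  assumes c: "0 < c"
  shows "luxemburg_norm \<Phi> (\<lambda>x. of_real c * f x) \<le> ennreal c * luxemburg_norm \<Phi> f"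
  unfolding luxemburg_norm_def[of \<Phi> f]
proof (rule le_mult_Inf_ennreal)
  fix l' assume "l' \<in> {ennreal l |l. 0 < l \<and> orlicz_modular \<Phi> f l \<le> 1}"
  then obtain l where l: "l' = ennreal l" "0 < l" "orlicz_modular \<Phi> f l \<le> 1" by auto
  have "orlicz_modular \<Phi> (\<lambda>x. of_real c * f x) (c * l) = orlicz_modular \<Phi> f l"
    using c by (simp add: orlicz_modular_def norm_mult)
  then have "luxemburg_norm \<Phi> (\<lambda>x. of_real c * f x) \<le> ennreal (c * l)"
    using c l by (intro luxemburg_norm_le) auto
  then show "luxemburg_norm \<Phi> (\<lambda>x. of_real c * f x) \<le> ennreal c * l'"
    using c l by (simp add: ennreal_mult)
qed (use c in auto)

lemma orlicz_modular_antimono: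
  assumes \<Phi>: "young_function \<Phi>" and l: "0 < l" "l \<le> l'"
  shows "orlicz_modular \<Phi> f l' \<le> orlicz_modular \<Phi> f l"
  unfolding orlicz_modular_def using l
  by (intro nn_integral_mono young_mono[OF \<Phi>]) (auto intro!: divide_left_mono)

text \<open>If the modular at every scale is at most 1, convexity makes it at most \<open>d\<close> for every \<open>d \<in> (0,1]\<close>, hence zero
  at every scale; a nonzero value of \<open>f\<close>, blown up enough, would reach a point where \<open>\<Phi>\<close> is positive.\<close>

lemma luxemburg_norm_zero:
  assumes \<Phi>: "young_function \<Phi>" and f[measurable]: "f \<in> borel_measurable borel"
    and zero: "luxemburg_norm \<Phi> f = 0"
  shows "AE x in lborel. f x = 0"
proof -
  note [measurable] = young_borel_measurable[OF \<Phi>]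
  have le1: "orlicz_modular \<Phi> f l \<le> 1" if "0 < l" for l
  proof -
    have "luxemburg_norm \<Phi> f < ennreal l" using zero that by simp
    then obtain k where "0 < k" "orlicz_modular \<Phi> f k \<le> 1" "ennreal k < ennreal l"
      unfolding luxemburg_norm_def Inf_less_iff by auto
    then show ?thesis
      using orlicz_modular_antimono[OF \<Phi>, of k l f] by (auto simp: ennreal_less_iff intro: order_trans)
  qed
  obtain z where z: "0 < z" "\<Phi> z \<noteq> 0"
  proof -
    obtain z where "\<Phi> z \<noteq> 0" "\<Phi> (- z) = \<Phi> z"
      using \<Phi> unfolding young_function_def by blast
    then show ?thesis
      using that[of "\<bar>z\<bar>"] young_zero[OF \<Phi>] by (cases z "0::real" rule: linorder_cases) auto
  qed
  have "AE x in lborel. \<Phi> (real (Suc n) * cmod (f x)) = 0" for n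
  proof -
    have small: "(\<integral>\<^sup>+x. \<Phi> (real (Suc n) * cmod (f x)) \<partial>lborel) \<le> 0 + ennreal e" if e: "0 < e" for e
    proof -
      \<comment> \<open>convexity only gives \<open>\<Phi> (d x) \<le> d \<Phi> x\<close> for \<open>d \<le> 1\<close>\<close>
      define d where "d = min e 1"
      have d: "0 < d" "d \<le> 1" "d \<le> e" using e by (auto simp: d_def)
      have "(\<integral>\<^sup>+x. \<Phi> (real (Suc n) * cmod (f x)) \<partial>lborel)
          \<le> (\<integral>\<^sup>+x. ennreal d * \<Phi> (cmod (f x) / (d / real (Suc n))) \<partial>lborel)"
      proof (rule nn_integral_mono)
        fix x
        show "\<Phi> (real (Suc n) * cmod (f x)) \<le> ennreal d * \<Phi> (cmod (f x) / (d / real (Suc n)))"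
          using young_scale[OF \<Phi>, of d "cmod (f x) / (d / real (Suc n))"] d by (simp add: mult.commute)
      qed
      also have "\<dots> = ennreal d * orlicz_modular \<Phi> f (d / real (Suc n))"
        unfolding orlicz_modular_def nn_integral_completion by (subst nn_integral_cmult) auto
      also have "\<dots> \<le> ennreal d * 1"
        using d le1 by (intro mult_left_mono) auto
      also have "\<dots> \<le> 0 + ennreal e"
        using d by (simp add: ennreal_leI)
      finally show ?thesis .
    qed
    have "(\<integral>\<^sup>+x. \<Phi> (real (Suc n) * cmod (f x)) \<partial>lborel) \<le> 0"
      by (rule ennreal_le_epsilon) (use small in auto)
    then show ?thesis
      by (subst (asm) le_zero_eq, subst (asm) nn_integral_0_iff_AE) auto
  qed
  then have "AE x in lborel. \<forall>n. \<Phi> (real (Suc n) * cmod (f x)) = 0"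
    by (simp add: AE_all_countable)
  then show ?thesis
  proof eventually_elim
    fix x assume 0: "\<forall>n. \<Phi> (real (Suc n) * cmod (f x)) = 0"
    show "f x = 0"
    proof (rule ccontr)
      assume nz: "f x \<noteq> 0"
      obtain n where "z / cmod (f x) < real n"
        using reals_Archimedean2 by blast
      then have "z / cmod (f x) < real (Suc n)"
        by simp
      then have "z < real (Suc n) * cmod (f x)"
        using nz by (simp add: pos_divide_less_eq)
      then show False
        using young_mono[OF \<Phi>, of z "real (Suc n) * cmod (f x)"] z 0 by auto
    qed
  qed
qed

text \<open>The change of variables halves the modular.  It shows that \<open>1\<close> is an admissible constant
  in the definition of \<open>C\<^sub>\<Phi>(2)\<close>, which is therefore finite.\<close>

lemma dilation_two_contractive:
  assumes \<Phi>: "young_function \<Phi>" and f[measurable]: "f \<in> borel_measurable lebesgue"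
  shows "luxemburg_norm \<Phi> (dilation 2 f) \<le> luxemburg_norm \<Phi> f"
proof -
  note [measurable] = young_borel_measurable[OF \<Phi>]
  have "orlicz_modular \<Phi> (dilation 2 f) l \<le> orlicz_modular \<Phi> f l" for l
  proof -
    have "orlicz_modular \<Phi> f l = ennreal 2 * orlicz_modular \<Phi> (dilation 2 f) l"
      unfolding orlicz_modular_def dilation_def
      by (subst nn_integral_real_affine_lebesgue[where c = 2 and t = 0]) auto
    moreover have "1 * orlicz_modular \<Phi> (dilation 2 f) l \<le> ennreal 2 * orlicz_modular \<Phi> (dilation 2 f) l"
      by (intro mult_right_mono) auto
    ultimately show ?thesis by simp
  qed
  then show ?thesis
    unfolding luxemburg_norm_def by (intro Inf_superset_mono) (auto intro: order_trans)
qed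

text \<open>Take infima over \<open>L > 2\<close> and over the scales admissible for \<open>f\<close> and for \<open>g\<close>, one after the other.
  The norm of \<open>f\<close> has to be positive and finite for the last infimum to pass through the product.\<close>

lemma luxemburg_norm_convolution_le:
  assumes \<Phi>1: "young_function \<Phi>1" and \<Phi>2: "young_function \<Phi>2" and \<Phi>3: "young_function \<Phi>3"
    and inv: "\<And>x::real. 0 \<le> x \<Longrightarrow>
           young_inv \<Phi>1 x * young_inv \<Phi>2 x \<le> ennreal x * young_inv \<Phi>3 x"
    and [measurable]: "f \<in> borel_measurable borel" "g \<in> borel_measurable borel"
    and fin: "0 < luxemburg_norm \<Phi>1 f" "luxemburg_norm \<Phi>1 f < \<infinity>"
  shows "luxemburg_norm \<Phi>3 (\<lambda>y. complex_of_real (enn2real (abs_convolution f g y)))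
           \<le> 2 * luxemburg_norm \<Phi>1 f * luxemburg_norm \<Phi>2 g"
    (is "?N \<le> _")
proof -
  have inf2: "Inf (ennreal ` {2<..}) \<le> ennreal 2"
  proof (rule ennreal_le_epsilon)
    fix e :: real assume "0 < e"
    then have "ennreal 2 + ennreal e = ennreal (2 + e)"
      by (intro ennreal_plus[symmetric]) auto
    then show "Inf (ennreal ` {2<..}) \<le> ennreal 2 + ennreal e"
      using \<open>0 < e\<close> by (intro Inf_lower image_eqI[where x = "2 + e"]) auto
  qed
  have *: "?N \<le> 2 * ennreal l2 * ennreal l1"
    if l: "0 < l1" "orlicz_modular \<Phi>1 f l1 \<le> 1" "0 < l2" "orlicz_modular \<Phi>2 g l2 \<le> 1" for l1 l2
  proof -
    have "?N \<le> (ennreal l2 * ennreal l1) * Inf (ennreal ` {2<..})"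
    proof (rule le_mult_Inf_ennreal)
      fix k assume "k \<in> ennreal ` {2<..}"
      then obtain L where L: "k = ennreal L" "2 < L" by auto
      have "?N \<le> ennreal (L * (l1 * l2))"
        using l L by (intro luxemburg_norm_le oneil_convolution_modular[OF \<Phi>1 \<Phi>2 \<Phi>3 inv]) auto
      also have "\<dots> = (ennreal l2 * ennreal l1) * k"
        using l L by (simp add: ennreal_mult mult_ac)
      finally show "?N \<le> (ennreal l2 * ennreal l1) * k" .
    qed (use l in \<open>auto simp: ennreal_zero_less_mult_iff ennreal_mult_less_top\<close>)
    also have "\<dots> \<le> (ennreal l2 * ennreal l1) * ennreal 2"
      using inf2 by (intro mult_left_mono) auto
    finally show ?thesis
      by (simp add: mult_ac)
  qed
  have "?N \<le> 2 * ennreal l2 * luxemburg_norm \<Phi>1 f" if "0 < l2" "orlicz_modular \<Phi>2 g l2 \<le> 1" for l2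
    unfolding luxemburg_norm_def[of \<Phi>1 f]
    using that * by (intro le_mult_Inf_ennreal) (auto simp: ennreal_zero_less_mult_iff ennreal_mult_less_top)
  then have "?N \<le> (2 * luxemburg_norm \<Phi>1 f) * luxemburg_norm \<Phi>2 g"
    unfolding luxemburg_norm_def[of \<Phi>2 g]
    using fin by (intro le_mult_Inf_ennreal) (auto simp: ennreal_zero_less_mult_iff ennreal_mult_less_top mult_ac)
  then show ?thesis .
qed

section \<open>Uniqueness and inversion of the Fourier transform\<close>

text \<open>At \<open>t = 0\<close> the two masses agree; after division by this common mass, Levy's theorem applies.\<close>

lemma density_unique_of_char_eq:
  fixes r1 r2 :: "real \<Rightarrow> real"
  assumes [measurable]: "integrable lborel r1" "integrable lborel r2"
    and nn: "\<And>x. 0 \<le> r1 x" "\<And>x. 0 \<le> r2 x"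
    and eq: "\<And>t. (LINT x|lborel. of_real (r1 x) * iexp (t * x)) = (LINT x|lborel. of_real (r2 x) * iexp (t * x))"
  shows "AE x in lborel. r1 x = r2 x"
proof -
  define c where "c = (LINT x|lborel. r1 x)"
  have c2: "c = (LINT x|lborel. r2 x)"
    using eq[of 0] by (simp add: c_def)
  have c0: "0 \<le> c" using nn by (simp add: c_def)
  show ?thesis
  proof (cases "c = 0")
    case True
    then have "AE x in lborel. r1 x = 0"
      using assms(1) nn by (simp add: c_def integral_nonneg_eq_0_iff_AE)
    moreover have "AE x in lborel. r2 x = 0"
      using True assms(2) nn by (simp add: c2 integral_nonneg_eq_0_iff_AE)
    ultimately show ?thesis by eventually_elim simp
  next
    case False
    with c0 have c: "0 < c" by simp
    define D where "D r = density lborel (\<lambda>x. ennreal (r x / c))" for r :: "real \<Rightarrow> real"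
    have D: "real_distribution (D r)"
      "char (D r) t = (LINT x|lborel. of_real (r x) * iexp (t * x)) / of_real c"
      if r: "integrable lborel r" "\<And>x. 0 \<le> r x" "(LINT x|lborel. r x) = c" for r t
    proof -
      note [measurable] = r(1)
      have "emeasure (D r) (space (D r)) = (\<integral>\<^sup>+x. ennreal (r x / c) \<partial>lborel)"
        by (simp add: D_def emeasure_density)
      also have "\<dots> = ennreal (LINT x|lborel. r x / c)"
        using r c by (intro nn_integral_eq_integral) auto
      also have "\<dots> = 1"
        using r c by simp
      finally interpret prob_space "D r"
        by (intro prob_spaceI)
      show "real_distribution (D r)"
        using prob_space_axioms
        by (simp add: D_def real_distribution_def real_distribution_axioms_def)
      have "char (D r) t = (LINT x|lborel. (r x / c) *\<^sub>R iexp (t * x))"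
        unfolding char_def D_def using r c by (intro integral_density) auto
      also have "\<dots> = (LINT x|lborel. of_real (r x) * iexp (t * x) / of_real c)"
        by (intro Bochner_Integration.integral_cong) (auto simp: scaleR_conv_of_real)
      also have "\<dots> = (LINT x|lborel. of_real (r x) * iexp (t * x)) / of_real c"
        by simp
      finally show "char (D r) t = (LINT x|lborel. of_real (r x) * iexp (t * x)) / of_real c" .
    qed
    have "D r1 = D r2"
      using D[of r1] D[of r2] assms c2 c_def
      by (intro Levy_uniqueness) (auto simp: fun_eq_iff)
    then have "AE x in lborel. ennreal (r1 x / c) = ennreal (r2 x / c)"
      unfolding D_def by (intro sigma_finite_measure.density_unique[OF sigma_finite_lborel]) auto
    then show ?thesis
      using nn c by (auto simp: field_simps)
  qed
qed

lemma integrable_iexp: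
  fixes q :: "real \<Rightarrow> complex"
  assumes "integrable lborel q"
  shows "integrable lborel (\<lambda>x. q x * iexp (t * x))"
proof -
  note [measurable] = borel_measurable_integrable[OF assms]
  show ?thesis
    by (rule Bochner_Integration.integrable_bound[OF assms]) (auto simp: norm_mult)
qed

text \<open>The positive and negative parts have the same transform.\<close>

lemma zero_of_char_zero_real:
  fixes r :: "real \<Rightarrow> real"
  assumes r: "integrable lborel r"
    and zero: "\<And>t. (LINT x|lborel. of_real (r x) * iexp (t * x)) = 0"
  shows "AE x in lborel. r x = 0"
proof -
  have i: "integrable lborel (\<lambda>x. max 0 (r x))" "integrable lborel (\<lambda>x. max 0 (- r x))"
    using r by auto
  have "(LINT x|lborel. of_real (max 0 (r x)) * iexp (t * x))
      = (LINT x|lborel. of_real (max 0 (- r x)) * iexp (t * x))" for t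
  proof -
    have "(LINT x|lborel. of_real (max 0 (r x)) * iexp (t * x))
          - (LINT x|lborel. of_real (max 0 (- r x)) * iexp (t * x))
        = (LINT x|lborel. of_real (max 0 (r x)) * iexp (t * x) - of_real (max 0 (- r x)) * iexp (t * x))"
      using i by (intro Bochner_Integration.integral_diff[symmetric] integrable_iexp) auto
    also have "\<dots> = (LINT x|lborel. of_real (r x) * iexp (t * x))"
      by (intro Bochner_Integration.integral_cong) (auto simp: max_def)
    finally show ?thesis using zero by simp
  qed
  then have "AE x in lborel. max 0 (r x) = max 0 (- r x)"
    using i by (intro density_unique_of_char_eq) auto
  then show ?thesis
    by eventually_elim (auto simp: max_def split: if_splits)
qed

text \<open>If the transform of \<open>q\<close> vanishes at every frequency, so does that of its conjugate, hence
  those of the real and imaginary parts.\<close>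

lemma zero_of_char_zero:
  fixes q :: "real \<Rightarrow> complex"
  assumes q: "integrable lborel q"
    and zero: "\<And>t. (LINT x|lborel. q x * iexp (t * x)) = 0"
  shows "AE x in lborel. q x = 0"
proof -
  have cz: "(LINT x|lborel. cnj (q x) * iexp (t * x)) = 0" for t
  proof -
    have "(LINT x|lborel. cnj (q x) * iexp (t * x)) = cnj (LINT x|lborel. q x * iexp (- t * x))"
      by (simp flip: Bochner_Integration.integral_cnj add: exp_cnj)
    then show ?thesis using zero[of "- t"] by simp
  qed
  have iq: "integrable lborel (\<lambda>x. cnj (q x))"
    using q by simp
  have "(LINT x|lborel. of_real (Re (q x)) * iexp (t * x)) = 0" for t
  proof -
    have "(LINT x|lborel. of_real (Re (q x)) * iexp (t * x))
       = (LINT x|lborel. (q x * iexp (t * x) + cnj (q x) * iexp (t * x)) / 2)"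
      by (intro Bochner_Integration.integral_cong) (auto simp: complex_eq_iff algebra_simps)
    also have "\<dots> = 0"
      using integrable_iexp[OF q, of t] integrable_iexp[OF iq, of t] zero cz by simp
    finally show ?thesis .
  qed
  then have 1: "AE x in lborel. Re (q x) = 0"
    using q by (intro zero_of_char_zero_real) auto
  have "(LINT x|lborel. of_real (Im (q x)) * iexp (t * x)) = 0" for t
  proof -
    have "(LINT x|lborel. of_real (Im (q x)) * iexp (t * x))
       = (LINT x|lborel. (q x * iexp (t * x) - cnj (q x) * iexp (t * x)) / (2 * \<i>))"
      by (intro Bochner_Integration.integral_cong) (auto simp: complex_diff_cnj simp flip: left_diff_distrib, auto simp: complex_eq_iff)
    also have "\<dots> = 0"
      using integrable_iexp[OF q, of t] integrable_iexp[OF iq, of t] zero cz by simp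
    finally show ?thesis .
  qed
  then have 2: "AE x in lborel. Im (q x) = 0"
    using q by (intro zero_of_char_zero_real) auto
  show ?thesis
    using 1 2 by eventually_elim (simp add: complex_eq_iff)
qed

text \<open>All applications of Fubini's theorem below have integrands of this form: two integrable factors in
  separate variables and a bounded kernel.\<close>

lemma integrable_pair_mult:
  fixes f g :: "real \<Rightarrow> complex" and k :: "real \<times> real \<Rightarrow> complex"
  assumes f: "integrable lborel f" and g: "integrable lborel g"
    and [measurable]: "k \<in> borel_measurable (lborel \<Otimes>\<^sub>M lborel)" and k: "\<And>z. norm (k z) \<le> B"
  shows "integrable (lborel \<Otimes>\<^sub>M lborel) (\<lambda>(x, y). f x * g y * k (x, y))"
proof -
  note [measurable] = borel_measurable_integrable[OF f] borel_measurable_integrable[OF g]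
  have "integrable (lborel \<Otimes>\<^sub>M lborel) (\<lambda>z. of_real B * (f (fst z) * g (snd z)))"
    using f g by (intro integrable_mult_right lborel_pair.Fubini_integrable) (auto simp: norm_mult)
  then show ?thesis
  proof (rule Bochner_Integration.integrable_bound)
    have "norm (f x * g y * k (x, y)) \<le> norm (f x * g y) * \<bar>B\<bar>" for x y
      unfolding norm_mult[of "f x * g y"] using k[of "(x, y)"] by (intro mult_left_mono) auto
    then show "AE z in lborel \<Otimes>\<^sub>M lborel.
        norm (case z of (x, y) \<Rightarrow> f x * g y * k (x, y)) \<le> norm (of_real B * (f (fst z) * g (snd z)))"
      by (auto simp: norm_mult mult_ac)
  qed measurable
qed

definition fourier_inverse :: "(real \<Rightarrow> complex) \<Rightarrow> real \<Rightarrow> complex" where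
  "fourier_inverse F x = (LINT \<xi>|lborel. F \<xi> * iexp (2 * pi * \<xi> * x))"

lemma fourier_inverse_bound:
  "norm (fourier_inverse F x) \<le> (LINT \<xi>|lborel. norm (F \<xi>))"
  unfolding fourier_inverse_def
  by (rule order_trans[OF integral_norm_bound]) (simp add: norm_mult)

lemma fourier_inverse_measurable [measurable]:
  assumes [measurable]: "F \<in> borel_measurable borel"
  shows "fourier_inverse F \<in> borel_measurable borel"
  unfolding fourier_inverse_def[abs_def] by measurable

lemma fourier_lborel:
  assumes "f \<in> borel_measurable borel"
  shows "fourier f \<xi> = (LINT x|lborel. f x * iexp (- 2 * pi * \<xi> * x))"
  using assms unfolding fourier_def
  by (subst integral_completion) (auto intro!: Bochner_Integration.integral_cong simp: mult_ac)

lemma fourier_measurable: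
  assumes [measurable]: "f \<in> borel_measurable borel"
  shows "fourier f \<in> borel_measurable borel"
  unfolding fourier_lborel[OF assms, abs_def] by measurable

lemma fourier_bound:
  assumes "f \<in> borel_measurable borel"
  shows "norm (fourier f \<xi>) \<le> (LINT x|lborel. norm (f x))"
  unfolding fourier_lborel[OF assms]
  by (rule order_trans[OF integral_norm_bound]) (simp add: norm_mult)

text \<open>The transform is bounded and vanishes off a compact set.\<close>

lemma fourier_integrable:
  assumes f: "f \<in> borel_measurable borel" and cpt: "compact (closure {\<xi>. fourier f \<xi> \<noteq> 0})"
  shows "integrable lborel (fourier f)"
proof -
  let ?K = "closure {\<xi>. fourier f \<xi> \<noteq> 0}"
  note [measurable] = fourier_measurable[OF f]
  have "integrable lborel (\<lambda>x. (LINT x|lborel. norm (f x)) * indicator ?K x)"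
    using emeasure_compact_finite[OF cpt]
    by (intro integrable_mult_right integrable_real_indicator) auto
  then show ?thesis
  proof (rule Bochner_Integration.integrable_bound)
    show "AE x in lborel. norm (fourier f x) \<le> norm ((LINT x|lborel. norm (f x)) * indicator ?K x)"
      using fourier_bound[OF f] closure_subset[of "{\<xi>. fourier f \<xi> \<noteq> 0}"]
      by (intro always_eventually allI) (auto simp: indicator_def abs_of_nonneg)
  qed measurable
qed

lemma gaussian_char: "(LINT x|lborel. of_real (std_normal_density x) * iexp (t * x)) = of_real (exp (- t\<^sup>2 / 2))"
proof -
  have "char std_normal_distribution t = (LINT x|lborel. std_normal_density x *\<^sub>R iexp (t * x))"
    unfolding char_def by (intro integral_density) auto
  then show ?thesis
    by (simp add: char_std_normal_distribution scaleR_conv_of_real)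
qed

text \<open>Let \<open>F\<close> be the inverse transform of \<open>fourier f\<close> and \<open>e\<close> the Gaussian.  Since the Gaussian is its own
  transform up to scaling, the transforms of \<open>f e\<close> and \<open>F e\<close> are both the convolution of \<open>fourier f\<close> with a
  Gaussian.  Multiplying by \<open>e\<close> makes the bounded function \<open>F\<close> integrable, so that uniqueness applies.\<close>

lemma fourier_inversion:
  assumes f: "integrable lborel f" and F: "integrable lborel (fourier f)"
  shows "AE x in lborel. f x = fourier_inverse (fourier f) x"
proof -
  note [measurable] = borel_measurable_integrable[OF f] borel_measurable_integrable[OF F]
  have fm: "f \<in> borel_measurable borel"
    by simp
  let ?F = "fourier f"
  define n where "n x = complex_of_real (std_normal_density x)" for x
  define e where "e x = exp (- x\<^sup>2 / 2)" for x :: real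
  have n: "integrable lborel n"
    unfolding n_def[abs_def] by auto
  note [measurable] = borel_measurable_integrable[OF n]
  have [measurable]: "e \<in> borel_measurable borel"
    unfolding e_def[abs_def] by measurable
  have e_n: "of_real (e x) = (LINT z|lborel. n z * iexp (x * z))" for x
    using gaussian_char[of x] by (simp add: n_def e_def)
  have n_e: "n x = of_real (e x) / of_real (sqrt (2 * pi))" for x
    by (simp add: n_def e_def std_normal_density_def)
  have e1: "norm (e x) \<le> 1" for x
    by (simp add: e_def)
  have fe: "integrable lborel (\<lambda>x. f x * of_real (e x))"
    by (rule Bochner_Integration.integrable_bound[OF f]) (auto simp: norm_mult intro!: mult_left_le e1[simplified])
  have ei: "integrable lborel (\<lambda>x. complex_of_real (e x))"
  proof -
    have "integrable lborel (\<lambda>x. of_real (sqrt (2 * pi)) * n x)"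
      using n by simp
    then show ?thesis by (simp add: n_e)
  qed
  have Fe: "integrable lborel (\<lambda>x. fourier_inverse ?F x * of_real (e x))"
  proof (rule Bochner_Integration.integrable_bound)
    show "integrable lborel (\<lambda>x. of_real (LINT \<xi>|lborel. norm (?F \<xi>)) * complex_of_real (e x))"
      using ei by simp
  qed (auto simp: norm_mult intro!: mult_right_mono fourier_inverse_bound order_trans[OF fourier_inverse_bound abs_ge_self])
  have "(LINT x|lborel. (f x * of_real (e x) - fourier_inverse ?F x * of_real (e x)) * iexp (t * x)) = 0" for t
  proof -
    have "(LINT x|lborel. f x * of_real (e x) * iexp (t * x))
        = (LINT x|lborel. (LINT z|lborel. f x * n z * iexp ((z + t) * x)))"
    proof (rule Bochner_Integration.integral_cong[OF refl])
      fix x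
      have "f x * of_real (e x) * iexp (t * x) = (LINT z|lborel. n z * iexp (x * z)) * (f x * iexp (t * x))"
        by (simp add: e_n)
      also have "\<dots> = (LINT z|lborel. n z * iexp (x * z) * (f x * iexp (t * x)))"
        by simp
      also have "\<dots> = (LINT z|lborel. f x * n z * iexp ((z + t) * x))"
        by (intro Bochner_Integration.integral_cong) (simp_all add: exp_add ring_distribs mult_ac)
      finally show "f x * of_real (e x) * iexp (t * x) = (LINT z|lborel. f x * n z * iexp ((z + t) * x))" .
    qed
    also have "\<dots> = (LINT z|lborel. (LINT x|lborel. f x * n z * iexp ((z + t) * x)))"
      using integrable_pair_mult[OF f n, of "\<lambda>(x, z). iexp ((z + t) * x)" 1]
      by (intro lborel_pair.Fubini_integral[symmetric]) (simp add: split_beta')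
    also have "\<dots> = (LINT z|lborel. n z * ?F (- (t / (2 * pi)) + - (1 / (2 * pi)) * z))"
    proof (rule Bochner_Integration.integral_cong[OF refl])
      fix z
      have phase: "- 2 * pi * (- (t / (2 * pi)) + - (1 / (2 * pi)) * z) * x = (z + t) * x" for x
        by (simp add: field_simps)
      have "(LINT x|lborel. f x * n z * iexp ((z + t) * x)) = (LINT x|lborel. n z * (f x * iexp ((z + t) * x)))"
        by (simp add: mult_ac)
      also have "\<dots> = n z * (LINT x|lborel. f x * iexp ((z + t) * x))"
        by simp
      also have "\<dots> = n z * ?F (- (t / (2 * pi)) + - (1 / (2 * pi)) * z)"
        unfolding fourier_lborel[OF fm] phase ..
      finally show "(LINT x|lborel. f x * n z * iexp ((z + t) * x)) = n z * ?F (- (t / (2 * pi)) + - (1 / (2 * pi)) * z)" .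
    qed
    also have "\<dots> = 2 * pi * (LINT \<xi>|lborel. n (2 * pi * \<xi> + t) * ?F \<xi>)"
    proof -
      have sym: "n (- x) = n x" for x
        by (simp add: n_def std_normal_density_def)
      have "(LINT z|lborel. n z * ?F (- (t / (2 * pi)) + - (1 / (2 * pi)) * z))
          = \<bar>- (2 * pi)\<bar> *\<^sub>R (LINT \<xi>|lborel. n (- t + - (2 * pi) * \<xi>) * ?F (- (t / (2 * pi)) + - (1 / (2 * pi)) * (- t + - (2 * pi) * \<xi>)))"
        by (rule lborel_integral_real_affine) simp
      also have "\<dots> = 2 * pi * (LINT \<xi>|lborel. n (2 * pi * \<xi> + t) * ?F \<xi>)"
        using sym[of "2 * pi * \<xi> + t" for \<xi>] by (simp add: scaleR_conv_of_real field_simps)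
      finally show ?thesis .
    qed
    finally have 1: "(LINT x|lborel. f x * of_real (e x) * iexp (t * x)) = 2 * pi * (LINT \<xi>|lborel. n (2 * pi * \<xi> + t) * ?F \<xi>)" .
    have "(LINT x|lborel. fourier_inverse ?F x * of_real (e x) * iexp (t * x))
        = (LINT x|lborel. (LINT \<xi>|lborel. of_real (e x) * ?F \<xi> * iexp ((2 * pi * \<xi> + t) * x)))"
    proof (rule Bochner_Integration.integral_cong[OF refl])
      fix x
      have "fourier_inverse ?F x * of_real (e x) * iexp (t * x)
          = (LINT \<xi>|lborel. ?F \<xi> * iexp (2 * pi * \<xi> * x)) * (of_real (e x) * iexp (t * x))"
        by (simp add: fourier_inverse_def)
      also have "\<dots> = (LINT \<xi>|lborel. ?F \<xi> * iexp (2 * pi * \<xi> * x) * (of_real (e x) * iexp (t * x)))"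
        by simp
      also have "\<dots> = (LINT \<xi>|lborel. of_real (e x) * ?F \<xi> * iexp ((2 * pi * \<xi> + t) * x))"
        by (intro Bochner_Integration.integral_cong) (simp_all add: exp_add ring_distribs mult_ac)
      finally show "fourier_inverse ?F x * of_real (e x) * iexp (t * x)
          = (LINT \<xi>|lborel. of_real (e x) * ?F \<xi> * iexp ((2 * pi * \<xi> + t) * x))" .
    qed
    also have "\<dots> = (LINT \<xi>|lborel. (LINT x|lborel. of_real (e x) * ?F \<xi> * iexp ((2 * pi * \<xi> + t) * x)))"
      using integrable_pair_mult[OF ei F, of "\<lambda>(x, \<xi>). iexp ((2 * pi * \<xi> + t) * x)" 1]
      by (intro lborel_pair.Fubini_integral[symmetric]) (simp add: split_beta')
    also have "\<dots> = (LINT \<xi>|lborel. of_real (2 * pi) * (n (2 * pi * \<xi> + t) * ?F \<xi>))"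
    proof (rule Bochner_Integration.integral_cong[OF refl])
      fix \<xi>
      have "(LINT x|lborel. of_real (e x) * ?F \<xi> * iexp ((2 * pi * \<xi> + t) * x))
          = (LINT x|lborel. (of_real (sqrt (2 * pi)) * ?F \<xi>) * (n x * iexp ((2 * pi * \<xi> + t) * x)))"
        by (intro Bochner_Integration.integral_cong) (simp_all add: n_e)
      also have "\<dots> = (of_real (sqrt (2 * pi)) * ?F \<xi>) * (LINT x|lborel. n x * iexp ((2 * pi * \<xi> + t) * x))"
        by simp
      also have "\<dots> = (of_real (sqrt (2 * pi)) * ?F \<xi>) * of_real (e (2 * pi * \<xi> + t))"
        by (simp only: e_n)
      also have "\<dots> = of_real (2 * pi) * (n (2 * pi * \<xi> + t) * ?F \<xi>)"
      proof -
        have "of_real (2 * pi) = (of_real (sqrt (2 * pi)) * of_real (sqrt (2 * pi)) :: complex)"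
          unfolding of_real_mult[symmetric] by simp
        then show ?thesis
          by (simp only: n_e) simp
      qed
      finally show "(LINT x|lborel. of_real (e x) * ?F \<xi> * iexp ((2 * pi * \<xi> + t) * x))
          = of_real (2 * pi) * (n (2 * pi * \<xi> + t) * ?F \<xi>)" .
    qed
    also have "\<dots> = 2 * pi * (LINT \<xi>|lborel. n (2 * pi * \<xi> + t) * ?F \<xi>)"
      by simp
    finally have 2: "(LINT x|lborel. fourier_inverse ?F x * of_real (e x) * iexp (t * x))
        = 2 * pi * (LINT \<xi>|lborel. n (2 * pi * \<xi> + t) * ?F \<xi>)" .
    show ?thesis
      unfolding left_diff_distrib
      using integrable_iexp[OF fe, of t] integrable_iexp[OF Fe, of t] 1 2
      by (subst Bochner_Integration.integral_diff) auto
  qed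
  then have "AE x in lborel. f x * of_real (e x) - fourier_inverse ?F x * of_real (e x) = 0"
    using fe Fe by (intro zero_of_char_zero) auto
  then show ?thesis
    by eventually_elim (simp add: e_def)
qed

lemma AE_fourier_inversion_reflect:
  assumes f: "integrable lborel f" and F: "integrable lborel (fourier f)"
  shows "AE t in lborel. f (y - t) = fourier_inverse (fourier f) (y - t)"
proof -
  note [measurable] = borel_measurable_integrable[OF f] borel_measurable_integrable[OF F]
  show ?thesis
    using AE_borel_affine[OF _ _ fourier_inversion[OF f F], of "-1" y] by simp
qed

section \<open>Pointwise control of the bilinear operator\<close>

lemma ennreal_norm_integral_le:
  fixes h :: "'a \<Rightarrow> complex"
  shows "ennreal (norm (integral\<^sup>L N h)) \<le> (\<integral>\<^sup>+x. ennreal (norm (h x)) \<partial>N)"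
proof (cases "integrable N h")
  case True
  then show ?thesis by (rule integral_norm_bound_ennreal)
next
  case False
  then have "integral\<^sup>L N h = 0" by (rule not_integrable_integral_eq)
  then show ?thesis by simp
qed

text \<open>By inversion \<open>f\<close> is essentially bounded, so the convolution is finite at every point.\<close>

lemma abs_convolution_finite:
  assumes f: "integrable lborel f" and F: "integrable lborel (fourier f)" and g: "integrable lborel g"
  shows "abs_convolution f g y < \<infinity>"
proof -
  note [measurable] = borel_measurable_integrable[OF g]
  let ?B = "LINT \<xi>|lborel. norm (fourier f \<xi>)"
  have "abs_convolution f g y \<le> (\<integral>\<^sup>+t. ennreal ?B * ennreal (cmod (g t)) \<partial>lborel)"
    unfolding abs_convolution_def
  proof (rule nn_integral_mono_AE, use AE_fourier_inversion_reflect[OF f F, of y] in eventually_elim)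
    fix t assume "f (y - t) = fourier_inverse (fourier f) (y - t)"
    then have "cmod (f (y - t)) \<le> ?B"
      using fourier_inverse_bound by simp
    then show "ennreal (cmod (f (y - t)) * cmod (g t)) \<le> ennreal ?B * ennreal (cmod (g t))"
      by (simp add: ennreal_mult'[symmetric] ennreal_leI mult_right_mono)
  qed
  also have "\<dots> = ennreal ?B * (\<integral>\<^sup>+t. ennreal (cmod (g t)) \<partial>lborel)"
    by (subst nn_integral_cmult) auto
  also have "\<dots> < \<infinity>"
    using g by (auto simp: integrable_iff_bounded ennreal_mult_less_top)
  finally show ?thesis .
qed

text \<open>Up to a phase, the integral on the left is the convolution at \<open>y\<close> of \<open>g\<close> with the modulation
  \<open>e\<^bsup>-2\<pi>iut\<^esup> f(t)\<close>: unfold \<open>fourier g\<close>, exchange the integrals, and invert the transform of \<open>f\<close>.  Only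
  the almost everywhere value of \<open>f\<close> enters, so the bound holds for every \<open>y\<close>.\<close>

lemma fourier_product_bound:
  assumes f: "integrable lborel f" and F: "integrable lborel (fourier f)" and g: "integrable lborel g"
  shows "ennreal (norm (LINT \<eta>|lborel. fourier f (\<eta> + u) * fourier g \<eta> * iexp (2 * pi * \<eta> * y)))
           \<le> abs_convolution f g y"
proof -
  note [measurable] = borel_measurable_integrable[OF f] borel_measurable_integrable[OF F]
    borel_measurable_integrable[OF g]
  have gm: "g \<in> borel_measurable borel"
    by simp
  let ?F = "fourier f"
  have Fu: "integrable lborel (\<lambda>\<eta>. ?F (\<eta> + u))"
    using lborel_integrable_real_affine[OF F, of 1 u] by (simp add: add.commute)
  have "(LINT \<eta>|lborel. ?F (\<eta> + u) * fourier g \<eta> * iexp (2 * pi * \<eta> * y))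
      = (LINT \<eta>|lborel. (LINT t|lborel. g t * ?F (\<eta> + u) * iexp (2 * pi * \<eta> * (y - t))))"
  proof (rule Bochner_Integration.integral_cong[OF refl])
    fix \<eta>
    have "?F (\<eta> + u) * fourier g \<eta> * iexp (2 * pi * \<eta> * y)
        = (LINT t|lborel. g t * iexp (- 2 * pi * \<eta> * t)) * (?F (\<eta> + u) * iexp (2 * pi * \<eta> * y))"
      by (simp add: fourier_lborel[OF gm] mult_ac)
    also have "\<dots> = (LINT t|lborel. g t * iexp (- 2 * pi * \<eta> * t) * (?F (\<eta> + u) * iexp (2 * pi * \<eta> * y)))"
      by simp
    also have "\<dots> = (LINT t|lborel. g t * ?F (\<eta> + u) * iexp (2 * pi * \<eta> * (y - t)))"
    proof (rule Bochner_Integration.integral_cong[OF refl])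
      fix t
      have "iexp (2 * pi * \<eta> * (y - t)) = iexp (- 2 * pi * \<eta> * t) * iexp (2 * pi * \<eta> * y)"
        by (simp add: algebra_simps flip: exp_add)
      then show "g t * iexp (- 2 * pi * \<eta> * t) * (?F (\<eta> + u) * iexp (2 * pi * \<eta> * y))
          = g t * ?F (\<eta> + u) * iexp (2 * pi * \<eta> * (y - t))"
        by (simp only: mult_ac)
    qed
    finally show "?F (\<eta> + u) * fourier g \<eta> * iexp (2 * pi * \<eta> * y)
        = (LINT t|lborel. g t * ?F (\<eta> + u) * iexp (2 * pi * \<eta> * (y - t)))" .
  qed
  also have "\<dots> = (LINT t|lborel. (LINT \<eta>|lborel. g t * ?F (\<eta> + u) * iexp (2 * pi * \<eta> * (y - t))))"
    using integrable_pair_mult[OF g Fu, of "\<lambda>(t, \<eta>). iexp (2 * pi * \<eta> * (y - t))" 1]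
    by (intro lborel_pair.Fubini_integral) (simp add: split_beta')
  also have "\<dots> = (LINT t|lborel. g t * (iexp (- 2 * pi * u * (y - t)) * fourier_inverse ?F (y - t)))"
  proof (rule Bochner_Integration.integral_cong[OF refl])
    fix t
    have "fourier_inverse ?F (y - t) = (LINT \<eta>|lborel. ?F (\<eta> + u) * iexp (2 * pi * (\<eta> + u) * (y - t)))"
      unfolding fourier_inverse_def
      using lborel_integral_real_affine[of 1 "\<lambda>\<xi>. ?F \<xi> * iexp (2 * pi * \<xi> * (y - t))" u]
      by (simp add: add.commute)
    then have "g t * (iexp (- 2 * pi * u * (y - t)) * fourier_inverse ?F (y - t))
        = g t * iexp (- 2 * pi * u * (y - t)) * (LINT \<eta>|lborel. ?F (\<eta> + u) * iexp (2 * pi * (\<eta> + u) * (y - t)))"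
      by (simp only: mult.assoc)
    also have "\<dots> = (LINT \<eta>|lborel. g t * iexp (- 2 * pi * u * (y - t)) * (?F (\<eta> + u) * iexp (2 * pi * (\<eta> + u) * (y - t))))"
      by simp
    also have "\<dots> = (LINT \<eta>|lborel. g t * ?F (\<eta> + u) * iexp (2 * pi * \<eta> * (y - t)))"
    proof (rule Bochner_Integration.integral_cong[OF refl])
      fix \<eta>
      have "iexp (2 * pi * \<eta> * (y - t)) = iexp (- 2 * pi * u * (y - t)) * iexp (2 * pi * (\<eta> + u) * (y - t))"
        by (simp add: algebra_simps flip: exp_add)
      then show "g t * iexp (- 2 * pi * u * (y - t)) * (?F (\<eta> + u) * iexp (2 * pi * (\<eta> + u) * (y - t)))
          = g t * ?F (\<eta> + u) * iexp (2 * pi * \<eta> * (y - t))"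
        by (simp only: mult_ac)
    qed
    finally show "(LINT \<eta>|lborel. g t * ?F (\<eta> + u) * iexp (2 * pi * \<eta> * (y - t)))
        = g t * (iexp (- 2 * pi * u * (y - t)) * fourier_inverse ?F (y - t))" ..
  qed
  finally have "ennreal (norm (LINT \<eta>|lborel. ?F (\<eta> + u) * fourier g \<eta> * iexp (2 * pi * \<eta> * y)))
      = ennreal (norm (LINT t|lborel. g t * (iexp (- 2 * pi * u * (y - t)) * fourier_inverse ?F (y - t))))"
    by (rule arg_cong)
  also have "\<dots> \<le> (\<integral>\<^sup>+t. norm (g t * (iexp (- 2 * pi * u * (y - t)) * fourier_inverse ?F (y - t))) \<partial>lborel)"
    by (rule ennreal_norm_integral_le)
  also have "\<dots> = abs_convolution f g y"
    unfolding abs_convolution_def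
  proof (rule nn_integral_cong_AE, use AE_fourier_inversion_reflect[OF f F, of y] in eventually_elim)
    fix t assume "f (y - t) = fourier_inverse ?F (y - t)"
    then show "ennreal (norm (g t * (iexp (- 2 * pi * u * (y - t)) * fourier_inverse ?F (y - t))))
        = ennreal (cmod (f (y - t)) * cmod (g t))"
      by (simp only: norm_mult norm_exp_i_times mult_1 mult.commute[of "cmod (g t)"])
  qed
  finally show ?thesis .
qed

text \<open>The substitution \<open>\<xi> = \<eta> + u\<close> makes the phase \<open>(\<xi> + \<eta>) x = u x + \<eta> (2 x)\<close>: this is where the
  dilation by 2 comes from.\<close>

lemma bilinear_op_bound:
  assumes f: "integrable lborel f" and F: "integrable lborel (fourier f)"
    and g: "integrable lborel g" and G: "integrable lborel (fourier g)"
    and M: "integrable lborel M"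
  shows "ennreal (norm (bilinear_op M f g x)) \<le> ennreal (LINT u|lborel. norm (M u)) * abs_convolution f g (2 * x)"
proof -
  note [measurable] = borel_measurable_integrable[OF f] borel_measurable_integrable[OF F]
    borel_measurable_integrable[OF g] borel_measurable_integrable[OF G] borel_measurable_integrable[OF M]
  have fm: "f \<in> borel_measurable borel" by simp
  let ?F = "fourier f" and ?G = "fourier g"
  define I where "I u = (LINT \<eta>|lborel. ?F (\<eta> + u) * ?G \<eta> * iexp (2 * pi * \<eta> * (2 * x)))" for u
  have "bilinear_op M f g x
      = (LINT \<eta>|lborel. (LINT \<xi>|lborel. ?F \<xi> * ?G \<eta> * M (\<xi> - \<eta>) * iexp (2 * pi * (\<xi> + \<eta>) * x)))"
  proof -
    have "(LINT \<xi>|lebesgue. ?F \<xi> * ?G \<eta> * M (\<xi> - \<eta>) *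
          exp (2 * of_real pi * \<i> * (of_real \<xi> + of_real \<eta>) * of_real x))
        = (LINT \<xi>|lborel. ?F \<xi> * ?G \<eta> * M (\<xi> - \<eta>) * iexp (2 * pi * (\<xi> + \<eta>) * x))" for \<eta>
      by (subst integral_completion) (auto intro!: Bochner_Integration.integral_cong simp: mult_ac)
    then show ?thesis
      unfolding bilinear_op_def by (simp add: integral_completion)
  qed
  also have "\<dots> = (LINT \<eta>|lborel. (LINT u|lborel. M u * ?G \<eta> * (?F (\<eta> + u) * iexp (2 * pi * (2 * \<eta> + u) * x))))"
  proof (rule Bochner_Integration.integral_cong[OF refl])
    fix \<eta>
    show "(LINT \<xi>|lborel. ?F \<xi> * ?G \<eta> * M (\<xi> - \<eta>) * iexp (2 * pi * (\<xi> + \<eta>) * x))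
        = (LINT u|lborel. M u * ?G \<eta> * (?F (\<eta> + u) * iexp (2 * pi * (2 * \<eta> + u) * x)))"
      by (subst lborel_integral_real_affine[where c = 1 and t = \<eta>])
         (auto intro!: Bochner_Integration.integral_cong simp: algebra_simps)
  qed
  also have "\<dots> = (LINT u|lborel. (LINT \<eta>|lborel. M u * ?G \<eta> * (?F (\<eta> + u) * iexp (2 * pi * (2 * \<eta> + u) * x))))"
    using integrable_pair_mult[OF M G, of "\<lambda>(u, \<eta>). ?F (\<eta> + u) * iexp (2 * pi * (2 * \<eta> + u) * x)"
        "LINT x|lborel. norm (f x)"] fourier_bound[OF fm]
    by (intro lborel_pair.Fubini_integral) (simp add: split_beta' norm_mult)
  also have "\<dots> = (LINT u|lborel. M u * iexp (2 * pi * u * x) * I u)"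
  proof (rule Bochner_Integration.integral_cong[OF refl])
    fix u
    have "(LINT \<eta>|lborel. M u * ?G \<eta> * (?F (\<eta> + u) * iexp (2 * pi * (2 * \<eta> + u) * x)))
        = (LINT \<eta>|lborel. M u * iexp (2 * pi * u * x) * (?F (\<eta> + u) * ?G \<eta> * iexp (2 * pi * \<eta> * (2 * x))))"
    proof (rule Bochner_Integration.integral_cong[OF refl])
      fix \<eta>
      have "iexp (2 * pi * (2 * \<eta> + u) * x) = iexp (2 * pi * u * x) * iexp (2 * pi * \<eta> * (2 * x))"
        by (simp add: algebra_simps flip: exp_add)
      then show "M u * ?G \<eta> * (?F (\<eta> + u) * iexp (2 * pi * (2 * \<eta> + u) * x))
          = M u * iexp (2 * pi * u * x) * (?F (\<eta> + u) * ?G \<eta> * iexp (2 * pi * \<eta> * (2 * x)))"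
        by (simp only: mult_ac)
    qed
    then show "(LINT \<eta>|lborel. M u * ?G \<eta> * (?F (\<eta> + u) * iexp (2 * pi * (2 * \<eta> + u) * x)))
        = M u * iexp (2 * pi * u * x) * I u"
      by (simp add: I_def)
  qed
  finally have "ennreal (norm (bilinear_op M f g x)) = ennreal (norm (LINT u|lborel. M u * iexp (2 * pi * u * x) * I u))"
    by (rule arg_cong)
  also have "\<dots> \<le> (\<integral>\<^sup>+u. norm (M u * iexp (2 * pi * u * x) * I u) \<partial>lborel)"
    by (rule ennreal_norm_integral_le)
  also have "\<dots> \<le> (\<integral>\<^sup>+u. ennreal (norm (M u)) * abs_convolution f g (2 * x) \<partial>lborel)"
    using fourier_product_bound[OF f F g, of _ "2 * x"]
    by (intro nn_integral_mono) (auto simp: norm_mult ennreal_mult I_def intro!: mult_left_mono)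
  also have "\<dots> = (\<integral>\<^sup>+u. ennreal (norm (M u)) \<partial>lborel) * abs_convolution f g (2 * x)"
    by (subst nn_integral_multc) auto
  also have "(\<integral>\<^sup>+u. ennreal (norm (M u)) \<partial>lborel) = ennreal (LINT u|lborel. norm (M u))"
    using M by (intro nn_integral_eq_integral) auto
  finally show ?thesis .
qed

text \<open>The constants \<open>c\<close> and \<open>m\<close> are strictly larger than \<open>C\<close> and the norm of \<open>M\<close>, hence positive.  This
  keeps the right-hand side infinite when one norm is infinite and the other nonzero.  When one norm is zero, the
  right-hand side is zero, by the convention \<open>0 * \<infinity> = 0\<close> even if the other norm is infinite; then the corresponding function vanishes almost
  everywhere and so does its transform.\<close>

lemma multiplier_estimate:
  assumes \<Phi>1: "young_function \<Phi>1" and \<Phi>2: "young_function \<Phi>2" and \<Phi>3: "young_function \<Phi>3"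
    and inv: "\<And>x::real. 0 \<le> x \<Longrightarrow>
           young_inv \<Phi>1 x * young_inv \<Phi>2 x \<le> ennreal x * young_inv \<Phi>3 x"
    and f: "integrable lborel f" and F: "integrable lborel (fourier f)"
    and g: "integrable lborel g" and G: "integrable lborel (fourier g)"
    and M: "integrable lborel M"
    and C: "0 \<le> C" "\<And>h. h \<in> orlicz_space \<Phi>3 \<Longrightarrow>
              luxemburg_norm \<Phi>3 (dilation 2 h) \<le> ennreal C * luxemburg_norm \<Phi>3 h"
    and c: "C < c" and m: "(LINT x|lborel. cmod (M x)) < m"
  shows "luxemburg_norm \<Phi>3 (bilinear_op M f g)
           \<le> ennreal (2 * c * m) * luxemburg_norm \<Phi>1 f * luxemburg_norm \<Phi>2 g"
proof -
  note [measurable] = borel_measurable_integrable[OF f] borel_measurable_integrable[OF g]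
  have fm: "f \<in> borel_measurable borel" and gm: "g \<in> borel_measurable borel"
    by simp_all
  let ?N1 = "luxemburg_norm \<Phi>1 f" and ?N2 = "luxemburg_norm \<Phi>2 g"
  have "0 \<le> (LINT x|lborel. cmod (M x))" by simp
  with c m C have pos: "0 < c" "0 < m" by linarith+
  have fourier_0: "fourier h = (\<lambda>_. 0)" if "h \<in> borel_measurable borel" "AE x in lborel. h x = 0" for h
  proof
    fix \<xi>
    have "(LINT x|lborel. h x * iexp (- 2 * pi * \<xi> * x)) = 0"
      by (rule integral_eq_zero_AE, use that(2) in eventually_elim) simp
    then show "fourier h \<xi> = 0"
      by (simp only: fourier_lborel[OF that(1)])
  qed
  consider "?N1 = 0" | "?N2 = 0" | "?N1 \<noteq> 0" "?N2 \<noteq> 0" "?N1 = \<infinity> \<or> ?N2 = \<infinity>"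
    | "0 < ?N1" "0 < ?N2" "?N1 < \<infinity>" "?N2 < \<infinity>"
    using less_top zero_less_iff_neq_zero by fastforce
  then show ?thesis
  proof cases
    case 1
    then have "fourier f = (\<lambda>_. 0)"
      by (intro fourier_0[OF fm] luxemburg_norm_zero[OF \<Phi>1 fm])
    then have "bilinear_op M f g = (\<lambda>_. 0)"
      by (simp add: bilinear_op_def fun_eq_iff)
    then show ?thesis by (simp add: luxemburg_norm_zero_fun[OF \<Phi>3])
  next
    case 2
    then have "fourier g = (\<lambda>_. 0)"
      by (intro fourier_0[OF gm] luxemburg_norm_zero[OF \<Phi>2 gm])
    then have "bilinear_op M f g = (\<lambda>_. 0)"
      by (simp add: bilinear_op_def fun_eq_iff)
    then show ?thesis by (simp add: luxemburg_norm_zero_fun[OF \<Phi>3])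
  next
    case 3
    then have "ennreal (2 * c * m) * ?N1 * ?N2 = \<top>"
      using pos by (auto simp: ennreal_mult_eq_top_iff ennreal_eq_0_iff not_le)
    then show ?thesis by simp
  next
    case 4
    define H where "H y = complex_of_real (enn2real (abs_convolution f g y))" for y
    have [measurable]: "H \<in> borel_measurable borel"
      unfolding H_def[abs_def] by measurable
    have NH: "luxemburg_norm \<Phi>3 H \<le> 2 * ?N1 * ?N2"
      unfolding H_def[abs_def] using 4 by (intro luxemburg_norm_convolution_le[OF \<Phi>1 \<Phi>2 \<Phi>3 inv]) auto
    also have "\<dots> < \<top>"
      using 4 by (simp add: ennreal_mult_less_top)
    finally obtain l where "0 < l" "orlicz_modular \<Phi>3 H l \<le> 1"
      unfolding luxemburg_norm_def Inf_less_iff by auto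
    then have "H \<in> orlicz_space \<Phi>3"
      unfolding orlicz_space_def by (auto intro!: exI[of _ l] intro: le_less_trans measurable_completion)
    then have D: "luxemburg_norm \<Phi>3 (dilation 2 H) \<le> ennreal C * luxemburg_norm \<Phi>3 H"
      by (rule C(2))
    have "cmod (bilinear_op M f g x) \<le> cmod (of_real m * dilation 2 H x)" for x
    proof -
      have fin: "abs_convolution f g (2 * x) = ennreal (enn2real (abs_convolution f g (2 * x)))"
        using abs_convolution_finite[OF f F g] by (simp add: ennreal_enn2real_if less_top)
      have "ennreal (cmod (bilinear_op M f g x))
          \<le> ennreal (LINT u|lborel. cmod (M u)) * abs_convolution f g (2 * x)"
        by (rule bilinear_op_bound[OF f F g G M])
      also have "\<dots> \<le> ennreal m * ennreal (enn2real (abs_convolution f g (2 * x)))"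
        unfolding fin[symmetric] using m by (intro mult_right_mono ennreal_leI) auto
      finally have "cmod (bilinear_op M f g x) \<le> m * enn2real (abs_convolution f g (2 * x))"
        using pos by (simp flip: ennreal_mult)
      then show ?thesis
        using pos by (simp add: H_def dilation_def norm_mult)
    qed
    then have "luxemburg_norm \<Phi>3 (bilinear_op M f g) \<le> luxemburg_norm \<Phi>3 (\<lambda>x. of_real m * dilation 2 H x)"
      by (intro luxemburg_norm_mono_AE[OF \<Phi>3]) auto
    also have "\<dots> \<le> ennreal m * luxemburg_norm \<Phi>3 (dilation 2 H)"
      using pos by (intro luxemburg_norm_scale_le)
    also have "\<dots> \<le> ennreal m * (ennreal C * luxemburg_norm \<Phi>3 H)"
      using D by (intro mult_left_mono) auto
    also have "\<dots> \<le> ennreal m * (ennreal c * (2 * ?N1 * ?N2))"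
      using c NH by (intro mult_left_mono mult_mono ennreal_leI) auto
    also have "\<dots> = ennreal (2 * c * m) * ?N1 * ?N2"
      using pos by (simp add: ennreal_mult mult_ac)
    finally show ?thesis .
  qed
qed

section \<open>Borel representatives\<close>

text \<open>Proved through a null Borel set containing the exceptions, since \<open>P\<close> may fail to be Borel measurable.\<close>

lemma AE_lborel_translate:
  assumes "AE x in lborel. P (x :: real)"
  shows "AE x in lborel. P (x - a)"
proof -
  obtain N where N: "N \<in> null_sets lborel" "{x \<in> space lborel. \<not> P x} \<subseteq> N"
    using assms by (auto simp: eventually_ae_filter)
  then have "AE x in lborel. x \<notin> N"
    by (intro AE_not_in)
  then have "AE x in lborel. - a + 1 * x \<notin> N"
    using N by (intro AE_borel_affine[where P = "\<lambda>x. x \<notin> N"]) auto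
  then show ?thesis
    by eventually_elim (use N in auto)
qed

text \<open>The functions \<open>(y, t) \<mapsto> f (y - t)\<close> and \<open>(\<xi>, \<eta>) \<mapsto> M (\<xi> - \<eta>)\<close> are measurable for the product of the
  Borel algebras when \<open>f\<close> and \<open>M\<close> are Borel, which the iterated integrals above use.  This lemma reduces the
  Lebesgue measurable case to that one.\<close>

lemma borel_representative:
  fixes f :: "real \<Rightarrow> complex"
  assumes [measurable]: "f \<in> borel_measurable lebesgue"
  shows "\<exists>f'\<in>borel_measurable borel. AE x in lborel. f x = f' x"
proof -
  obtain a b where [measurable]: "a \<in> borel_measurable lborel" "b \<in> borel_measurable lborel"
    and ae: "AE x in lborel. Re (f x) = a x" "AE x in lborel. Im (f x) = b x"
    using completion_ex_borel_measurable_real[of "\<lambda>x. Re (f x)" lborel]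
      completion_ex_borel_measurable_real[of "\<lambda>x. Im (f x)" lborel] by auto
  have "(\<lambda>x. of_real (a x) + \<i> * of_real (b x)) \<in> borel_measurable borel"
    by measurable
  moreover have "AE x in lborel. f x = of_real (a x) + \<i> * of_real (b x)"
    using ae by eventually_elim (simp add: complex_eq_iff)
  ultimately show ?thesis
    by (intro bexI[where x = "\<lambda>x. of_real (a x) + \<i> * of_real (b x)"])
qed

lemma integral_lebesgue_cong_AE:
  fixes h h' :: "real \<Rightarrow> complex"
  assumes "h \<in> borel_measurable lebesgue" "h' \<in> borel_measurable lebesgue" "AE x in lborel. h x = h' x"
  shows "integral\<^sup>L lebesgue h = integral\<^sup>L lebesgue h'"
  using assms by (intro integral_cong_AE) (auto intro: AE_completion)

lemma integrable_representative:
  fixes f :: "real \<Rightarrow> complex"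
  assumes f: "integrable lebesgue f"
  obtains f' where "integrable lborel f'" "f' \<in> borel_measurable borel" "AE x in lborel. f x = f' x"
proof -
  obtain f' where f': "f' \<in> borel_measurable borel" "AE x in lborel. f x = f' x"
    using borel_representative borel_measurable_integrable[OF f] by blast
  have "integrable lebesgue f'"
    by (rule integrable_cong_AE_imp[OF f])
       (use f' in \<open>auto intro: AE_completion measurable_completion\<close>)
  then have "integrable lborel f'"
    using f' by (simp add: integrable_completion)
  with f' that show ?thesis by blast
qed

lemma fourier_cong_AE:
  assumes "f \<in> borel_measurable lebesgue" "f' \<in> borel_measurable lebesgue"
    and ae: "AE x in lborel. f x = f' x"
  shows "fourier f = fourier f'"
proof
  fix \<xi>
  have phase: "(\<lambda>x. exp (- 2 * of_real pi * \<i> * of_real x * of_real \<xi>) :: complex) \<in> borel_measurable lebesgue"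
    by (intro measurable_completion) simp
  show "fourier f \<xi> = fourier f' \<xi>"
    unfolding fourier_def
  proof (rule integral_lebesgue_cong_AE)
    show "AE x in lborel. f x * exp (- 2 * of_real pi * \<i> * of_real x * of_real \<xi>)
        = f' x * exp (- 2 * of_real pi * \<i> * of_real x * of_real \<xi>)"
      using ae by eventually_elim simp
  qed (rule borel_measurable_times[OF assms(1) phase] borel_measurable_times[OF assms(2) phase])+
qed

lemma bilinear_op_cong_AE:
  assumes M[measurable]: "M \<in> borel_measurable lebesgue" and M'[measurable]: "M' \<in> borel_measurable borel"
    and ae: "AE x in lborel. M x = M' x"
    and F: "fourier f = fourier f'" "fourier f' \<in> borel_measurable borel" and G: "fourier g = fourier g'"
  shows "bilinear_op M f g = bilinear_op M' f' g'"
proof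
  fix x
  have "(LINT \<xi>|lebesgue. fourier f' \<xi> * fourier g' \<eta> * M (\<xi> - \<eta>) *
          exp (2 * of_real pi * \<i> * (of_real \<xi> + of_real \<eta>) * of_real x))
      = (LINT \<xi>|lebesgue. fourier f' \<xi> * fourier g' \<eta> * M' (\<xi> - \<eta>) *
          exp (2 * of_real pi * \<i> * (of_real \<xi> + of_real \<eta>) * of_real x))" for \<eta>
  proof (rule integral_lebesgue_cong_AE)
    have "(\<lambda>\<xi>. - \<eta> + 1 * \<xi>) \<in> lebesgue \<rightarrow>\<^sub>M lebesgue"
      using lebesgue_affine_measurable[of "\<lambda>_. 1" "- \<eta>"] by simp
    then have "(\<lambda>\<xi>. \<xi> - \<eta>) \<in> lebesgue \<rightarrow>\<^sub>M lebesgue"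
      by simp
    then have M_shift: "(\<lambda>\<xi>. M (\<xi> - \<eta>)) \<in> borel_measurable lebesgue"
      using M by (rule measurable_compose)
    have M'_shift: "(\<lambda>\<xi>. M' (\<xi> - \<eta>)) \<in> borel_measurable lebesgue"
      by (intro measurable_completion) simp
    have phase: "(\<lambda>\<xi>. exp (2 * of_real pi * \<i> * (of_real \<xi> + of_real \<eta>) * of_real x) :: complex)
        \<in> borel_measurable lebesgue"
      by (intro measurable_completion) simp
    have F_meas: "fourier f' \<in> borel_measurable lebesgue"
      using F(2) by (intro measurable_completion) simp
    show "(\<lambda>\<xi>. fourier f' \<xi> * fourier g' \<eta> * M (\<xi> - \<eta>) *
          exp (2 * of_real pi * \<i> * (of_real \<xi> + of_real \<eta>) * of_real x)) \<in> borel_measurable lebesgue"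
      by (intro borel_measurable_times borel_measurable_const F_meas M_shift phase)
    show "(\<lambda>\<xi>. fourier f' \<xi> * fourier g' \<eta> * M' (\<xi> - \<eta>) *
          exp (2 * of_real pi * \<i> * (of_real \<xi> + of_real \<eta>) * of_real x)) \<in> borel_measurable lebesgue"
      by (intro borel_measurable_times borel_measurable_const F_meas M'_shift phase)
    show "AE \<xi> in lborel. fourier f' \<xi> * fourier g' \<eta> * M (\<xi> - \<eta>) *
          exp (2 * of_real pi * \<i> * (of_real \<xi> + of_real \<eta>) * of_real x)
        = fourier f' \<xi> * fourier g' \<eta> * M' (\<xi> - \<eta>) *
          exp (2 * of_real pi * \<i> * (of_real \<xi> + of_real \<eta>) * of_real x)"
      using AE_lborel_translate[OF ae, of \<eta>] by eventually_elim simp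
  qed
  then show "bilinear_op M f g x = bilinear_op M' f' g' x"
    unfolding bilinear_op_def F(1) G by simp
qed

section \<open>The multiplier theorem\<close>

text \<open>Only strict bounds for the constants \<open>C\<close> and \<open>\<parallel>M\<parallel>\<^sub>1\<close> are available from \<open>multiplier_estimate\<close>, and the
  constants in the multiplier norm have to be positive.  So one proves the bound with \<open>C + e\<close> and \<open>\<parallel>M\<parallel>\<^sub>1 + e\<close>, lets \<open>e\<close> decrease to
  \<open>0\<close>, and then takes the infimum over \<open>C\<close>.  If \<open>\<parallel>M\<parallel>\<^sub>1 = 0\<close> that infimum does not pass through the product, and
  the single admissible constant \<open>C = 1\<close> is enough.\<close>

theorem theorem4p2:
  fixes \<Phi>1 \<Phi>2 \<Phi>3 :: "real \<Rightarrow> ennreal" and M :: "real \<Rightarrow> complex"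
  assumes "young_function \<Phi>1" and "young_function \<Phi>2" and "young_function \<Phi>3"
    and "\<And>x::real. 0 \<le> x \<Longrightarrow>
           young_inv \<Phi>1 x * young_inv \<Phi>2 x \<le> ennreal x * young_inv \<Phi>3 x"
    and "integrable lebesgue M"
  shows "M \<in> multiplier_space \<Phi>1 \<Phi>2 \<Phi>3 \<and>
         multiplier_norm \<Phi>1 \<Phi>2 \<Phi>3 M
           \<le> 2 * dilation_norm \<Phi>3 2 * ennreal (LINT x|lebesgue. cmod (M x))"
proof -
  note \<Phi>1 = assms(1) and \<Phi>2 = assms(2) and \<Phi>3 = assms(3) and inv = assms(4) and M = assms(5)
  define m where "m = (LINT x|lebesgue. cmod (M x))"
  have m0: "0 \<le> m" by (simp add: m_def)
  define S where "S = {C. 0 \<le> C \<and>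
    (\<forall>h \<in> orlicz_space \<Phi>3. luxemburg_norm \<Phi>3 (dilation 2 h) \<le> ennreal C * luxemburg_norm \<Phi>3 h)}"
  obtain M' where M': "integrable lborel M'" "M' \<in> borel_measurable borel" "AE x in lborel. M x = M' x"
    using integrable_representative[OF M] by blast
  have m': "(LINT x|lborel. cmod (M' x)) = m"
  proof -
    have "(LINT x|lborel. cmod (M' x)) = (LINT x|lebesgue. cmod (M' x))"
      using M' by (subst integral_completion) auto
    also have "\<dots> = m"
      unfolding m_def
    proof (rule integral_cong_AE)
      show "(\<lambda>x. cmod (M' x)) \<in> borel_measurable lebesgue"
        using M'(2) by (intro measurable_completion) simp
      show "(\<lambda>x. cmod (M x)) \<in> borel_measurable lebesgue"
        using borel_measurable_integrable[OF M] by simp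
      show "AE x in lebesgue. cmod (M' x) = cmod (M x)"
        using AE_completion[OF M'(3)] by eventually_elim simp
    qed
    finally show ?thesis .
  qed
  have bound: "multiplier_bound \<Phi>1 \<Phi>2 \<Phi>3 M (2 * (C + e) * (m + e))" if C: "C \<in> S" and e: "0 < e" for C e
    unfolding multiplier_bound_def
  proof (intro ballI)
    fix f g assume fg: "f \<in> compact_spectrum" "g \<in> compact_spectrum"
    have f: "integrable lebesgue f" and cf: "compact (closure {\<xi>. fourier f \<xi> \<noteq> 0})"
      and g: "integrable lebesgue g" and cg: "compact (closure {\<xi>. fourier g \<xi> \<noteq> 0})"
      using fg by (auto simp: compact_spectrum_def)
    obtain f' where f': "integrable lborel f'" "f' \<in> borel_measurable borel" "AE x in lborel. f x = f' x"
      using integrable_representative[OF f] by blast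
    obtain g' where g': "integrable lborel g'" "g' \<in> borel_measurable borel" "AE x in lborel. g x = g' x"
      using integrable_representative[OF g] by blast
    have F: "fourier f = fourier f'"
      using f f' by (intro fourier_cong_AE) (auto intro: measurable_completion)
    have G: "fourier g = fourier g'"
      using g g' by (intro fourier_cong_AE) (auto intro: measurable_completion)
    have "luxemburg_norm \<Phi>3 (bilinear_op M' f' g')
           \<le> ennreal (2 * (C + e) * (m + e)) * luxemburg_norm \<Phi>1 f' * luxemburg_norm \<Phi>2 g'"
      using C e f' g' cf cg m' F G
      by (intro multiplier_estimate[OF \<Phi>1 \<Phi>2 \<Phi>3 inv _ _ _ _ M'(1), where C = C] fourier_integrable)
         (auto simp: S_def)
    moreover have "bilinear_op M f g = bilinear_op M' f' g'"
      using M M' f'(2) F G by (intro bilinear_op_cong_AE fourier_measurable) auto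
    ultimately show "luxemburg_norm \<Phi>3 (bilinear_op M f g)
           \<le> ennreal (2 * (C + e) * (m + e)) * luxemburg_norm \<Phi>1 f * luxemburg_norm \<Phi>2 g"
      using luxemburg_norm_cong_AE[OF \<Phi>1 f'(3)] luxemburg_norm_cong_AE[OF \<Phi>2 g'(3)] by simp
  qed
  have S0: "0 \<le> C" if "C \<in> S" for C
    using that by (simp add: S_def)
  have one: "1 \<in> S"
    using dilation_two_contractive[OF \<Phi>3] by (auto simp: S_def orlicz_space_def)
  have "set_integrable lebesgue K M" if "compact K" for K
    unfolding set_integrable_def using M that
    by (intro integrable_mult_indicator) (auto intro: lmeasurable_compact fmeasurableD)
  then have "locally_integrable M"
    by (simp add: locally_integrable_def)
  moreover have "\<exists>C>0. multiplier_bound \<Phi>1 \<Phi>2 \<Phi>3 M C"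
    using bound[OF one, of 1] m0 by (intro exI[of _ "2 * (1 + 1) * (m + 1)"]) auto
  ultimately have "M \<in> multiplier_space \<Phi>1 \<Phi>2 \<Phi>3"
    by (simp add: multiplier_space_def)
  moreover have "multiplier_norm \<Phi>1 \<Phi>2 \<Phi>3 M \<le> 2 * dilation_norm \<Phi>3 2 * ennreal m"
  proof -
    have le: "multiplier_norm \<Phi>1 \<Phi>2 \<Phi>3 M \<le> ennreal (2 * C * m)" if C: "C \<in> S" for C
    proof (rule tendsto_lowerbound)
      show "((\<lambda>e. ennreal (2 * (C + e) * (m + e))) \<longlongrightarrow> ennreal (2 * C * m)) (at_right 0)"
        by (intro tendsto_ennrealI) (auto intro!: tendsto_eq_intros)
      show "\<forall>\<^sub>F e in at_right 0. multiplier_norm \<Phi>1 \<Phi>2 \<Phi>3 M \<le> ennreal (2 * (C + e) * (m + e))"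
        using eventually_at_right_less[of "0::real"]
      proof eventually_elim
        fix e :: real assume e: "0 < e"
        then have "0 < 2 * (C + e) * (m + e)"
          using m0 S0[OF C] by (intro mult_pos_pos) auto
        then show "multiplier_norm \<Phi>1 \<Phi>2 \<Phi>3 M \<le> ennreal (2 * (C + e) * (m + e))"
          unfolding multiplier_norm_def using bound[OF C e] by (intro Inf_lower) auto
      qed
    qed simp
    show ?thesis
    proof (cases "m = 0")
      case True
      then show ?thesis using le[OF one] by simp
    next
      case False
      have "multiplier_norm \<Phi>1 \<Phi>2 \<Phi>3 M \<le> ennreal (2 * m) * dilation_norm \<Phi>3 2"
        unfolding dilation_norm_def
      proof (rule le_mult_Inf_ennreal)
        fix l assume "l \<in> {ennreal C |C. 0 \<le> C \<and> (\<forall>f\<in>orlicz_space \<Phi>3.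
            luxemburg_norm \<Phi>3 (dilation 2 f) \<le> ennreal C * luxemburg_norm \<Phi>3 f)}"
        then obtain C where C: "l = ennreal C" "C \<in> S"
          by (auto simp: S_def)
        have "ennreal (2 * C * m) = ennreal (2 * m) * l"
          using C S0 m0 by (simp add: mult_ac flip: ennreal_mult)
        then show "multiplier_norm \<Phi>1 \<Phi>2 \<Phi>3 M \<le> ennreal (2 * m) * l"
          using le[OF C(2)] by simp
      qed (use m0 False in auto)
      also have "\<dots> = 2 * dilation_norm \<Phi>3 2 * ennreal m"
        using m0 by (simp add: ennreal_mult mult_ac)
      finally show ?thesis .
    qed
  qed
  ultimately show ?thesis
    by (simp add: m_def)
qed

end
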